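(* Let $n\geq k\geq 3$ be integers and let $\varepsilon$ be a real number with $0<\varepsilon\leq\frac{1}{58}$. Suppose that $\mathcal{F},\mathcal{G}\subset\binom{[n]}{k}$ are cross-intersecting with $|\mathcal{F}|,|\mathcal{G}|\geq\frac{1}{\varepsilon}\binom{n-3}{k-3}$. Then $\max\{\varrho(\mathcal{F}),\varrho(\mathcal{G})\}>\frac{1}{2}-\varepsilon$.
   Context: $[n]=\{1,\ldots,n\}$ and $\binom{[n]}{k}$ is the collection of all $k$-element subsets of $[n]$. Families $\mathcal{F},\mathcal{G}$ are cross-intersecting if $F\cap G\neq\emptyset$ for all $F\in\mathcal{F}$, $G\in\mathcal{G}$. For a family $\mathcal{H}\subset\binom{[n]}{k}$ and $i\in[n]$ put $\mathcal{H}(i)=\{H\setminus\{i\}: i\in H\in\mathcal{H}\}$, and for nonempty $\mathcal{H}$ put $\varrho(\mathcal{H})=\max_{1\leq i\leq n}|\mathcal{H}(i)|/|\mathcal{H}|$. *)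

theory Defs
  imports Complex_Main "HOL-Library.Ramsey"
begin

definition cross_intersecting :: "nat set set \<Rightarrow> nat set set \<Rightarrow> bool" where
  "cross_intersecting \<F> \<G> \<longleftrightarrow> (\<forall>F\<in>\<F>. \<forall>G\<in>\<G>. F \<inter> G \<noteq> {})"

definition link :: "nat set set \<Rightarrow> nat \<Rightarrow> nat set set" where
  "link \<H> i = {H - {i} | H. H \<in> \<H> \<and> i \<in> H}"

text \<open>The maximal relative degree of a family on the ground set \<open>{1..n}\<close>. It is meaningful only
  for \<open>n \<ge> 1\<close> and a finite nonempty family.\<close>
definition rho :: "nat \<Rightarrow> nat set set \<Rightarrow> real" where
  "rho n \<H> = (MAX i\<in>{1..n}. real (card (link \<H> i)) / real (card \<H>))"

end

theory Submission
  imports Defs "HOL-Library.Disjoint_Sets"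
begin

text \<open>
  Write \<open>N = (n - 3) choose (k - 3)\<close> and suppose that every point lies in at most
  \<open>|\<F>| / 2 - s\<close> members of \<open>\<F>\<close> and in at most \<open>|\<G>| / 2 - t\<close> members of \<open>\<G>\<close>, where
  \<open>s = \<epsilon> |\<F>| \<ge> N\<close> and \<open>t = \<epsilon> |\<G>| \<ge> N\<close>. The proof derives a contradiction by shifting.

  Call a family stable if replacing an element of a member by a smaller new element never leaves
  the family. If \<open>\<F>\<close> and \<open>\<G>\<close> are cross-intersecting and \<open>\<G>\<close> is stable, then any
  \<open>A \<in> \<F>\<close> and \<open>B \<in> \<G>\<close> together have more than \<open>x\<close> elements in some initial segment of length
  \<open>x\<close> (\<open>stable_cross_prefix\<close>). Hence if the lattice path of some \<open>A\<close> never reaches height \<open>h\<close>,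
  then the path of every \<open>B\<close> reaches height \<open>3 - h\<close> (\<open>stable_cross_reach\<close>), and there are few sets
  whose path reaches a given height (\<open>card_reach_le\<close>). At most \<open>|\<G>| - 2 t\<close> members of \<open>\<G>\<close>
  meet a given pair of points, so at least \<open>2 N\<close> members miss it, and unrestricted shifting of the
  remaining sets shows that no pair of points lies in more than \<open>2 N\<close> members of \<open>\<F>\<close>
  (\<open>codegree\<close>).

  Now choose, among all cross-intersecting pairs with the same sizes and the same degree bounds, one
  whose total sum of elements is least. For each pair of points \<open>i < j\<close> both families are stable
  under the shift from \<open>j\<close> to \<open>i\<close>, unless this shift would break a degree bound. In the latter
  case \<open>{i, j}\<close> is congested: nearly half of \<open>\<F>\<close> or nearly half of \<open>\<G>\<close> meets it. Three disjoint
  congested pairs of one family are impossible, because the codegrees are small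
  (\<open>no_three_congested\<close>). So a maximal matching of congested pairs has at most four edges, and
  both families are stable outside the set \<open>Q\<close> of at most eight points that it covers.

  If some \<open>A \<in> \<F>\<close> with \<open>A \<inter> Q = {a}\<close> does not reach height 1 outside \<open>Q\<close>, then all members of
  \<open>\<G>\<close> that avoid \<open>a\<close> reach height 2 there. There are at most \<open>18 N\<close> of them, although the degree
  bound leaves at least \<open>30 N\<close>. Consequently few members of \<open>\<F>\<close> meet \<open>Q\<close> in a single point,
  and the small codegrees leave few with several points in \<open>Q\<close> and one on a given edge, so that no edge
  of the matching is congested (\<open>not_congested\<close>). Without congested pairs the whole pair is stable,
  and then the point 1 lies in almost all members of \<open>\<F>\<close> (\<open>congested_edge\<close>), which is again
  impossible.
\<close>

section \<open>Counting sets by the height of their lattice path\<close>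

text \<open>
  Read the elements of \<open>R\<close> in increasing order as steps of a path, up for elements of \<open>A\<close> and
  down for the others. The predicate says that after at least one step the path is at height
  \<open>s\<close> or more. Counting both kinds of steps by cardinalities avoids negative heights.
\<close>

definition reach :: "nat \<Rightarrow> nat set \<Rightarrow> nat set \<Rightarrow> bool" where
  "reach s R A \<longleftrightarrow> (\<exists>x\<in>R. card (R \<inter> {..x}) + s \<le> 2 * card (A \<inter> R \<inter> {..x}))"

lemma reach_le_card:
  assumes "finite R" and "reach s R A"
  shows "s \<le> card (A \<inter> R)"
proof -
  obtain x where x: "card (R \<inter> {..x}) + s \<le> 2 * card (A \<inter> R \<inter> {..x})"
    using assms(2) by (auto simp: reach_def)
  have "card (A \<inter> R \<inter> {..x}) \<le> card (R \<inter> {..x})"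
    by (rule card_mono) (use assms in auto)
  moreover have "card (A \<inter> R \<inter> {..x}) \<le> card (A \<inter> R)"
    by (rule card_mono) (use assms in auto)
  ultimately show ?thesis using x by linarith
qed

lemma reach_cong: "A \<inter> R = B \<inter> R \<Longrightarrow> reach s R A \<longleftrightarrow> reach s R B"
  by (simp add: reach_def)

lemma reach_mono: "reach s R A \<Longrightarrow> s' \<le> s \<Longrightarrow> reach s' R A"
  unfolding reach_def by (meson add_left_mono le_trans)

lemma card_prefix_remove_Min:
  fixes R :: "nat set"
  assumes "finite R" and "x \<in> R" and "A \<subseteq> R"
  shows "card (A \<inter> {..x}) = card ((A - {Min R}) \<inter> {..x}) + (if Min R \<in> A then 1 else 0)"
proof (cases "Min R \<in> A")
  case True
  have "A \<inter> {..x} = insert (Min R) ((A - {Min R}) \<inter> {..x})"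
    using True assms by auto
  then show ?thesis using True assms finite_subset[of A R] by simp
qed auto

lemma reach_Min_notin:
  assumes "finite R" and "reach s R A" and "Min R \<notin> A"
  shows "reach (Suc s) (R - {Min R}) A"
proof -
  obtain x where x: "x \<in> R" "card (R \<inter> {..x}) + s \<le> 2 * card (A \<inter> R \<inter> {..x})"
    using assms(2) by (auto simp: reach_def)
  have "card (R \<inter> {..x}) = Suc (card ((R - {Min R}) \<inter> {..x}))"
    using card_prefix_remove_Min[OF assms(1) x(1), of R] x(1) assms(1)
    by (metis Min_in One_nat_def Suc_eq_plus1 empty_iff order_refl)
  moreover have "A \<inter> (R - {Min R}) = A \<inter> R" using assms(3) by auto
  moreover have "x \<noteq> Min R"
  proof
    assume "x = Min R"
    then have "A \<inter> R \<inter> {..x} = {}"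
      using assms(1,3) by (auto simp: Min_le_iff) (metis Min_le antisym)
    then have "card (R \<inter> {..x}) = 0" using x(2) by (metis add_is_0 card.empty le_zero_eq mult_0_right)
    then show False using x(1) assms(1) by auto
  qed
  ultimately have "x \<in> R - {Min R}" "card ((R - {Min R}) \<inter> {..x}) + Suc s \<le> 2 * card (A \<inter> (R - {Min R}) \<inter> {..x})"
    using x by auto
  then show ?thesis unfolding reach_def by blast
qed

text \<open>
  Deleting an up step at the start lowers all later heights by one, and deleting a down step raises
  them. The height demanded is at least 2 because height 1 may already be attained by the first step alone.
\<close>

lemma reach_Min_in:
  assumes "finite R" and "reach (Suc (Suc s)) R A"
  shows "reach (Suc s) (R - {Min R}) A"
proof (cases "Min R \<in> A")
  case False
  then show ?thesis using reach_Min_notin[OF assms] reach_mono by (meson le_SucI order_refl)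
next
  case True
  obtain x where x: "x \<in> R" "card (R \<inter> {..x}) + Suc (Suc s) \<le> 2 * card (A \<inter> R \<inter> {..x})"
    using assms(2) by (auto simp: reach_def)
  have R: "card (R \<inter> {..x}) = Suc (card ((R - {Min R}) \<inter> {..x}))"
    using card_prefix_remove_Min[OF assms(1) x(1), of R] x(1) assms(1)
    by (metis Min_in One_nat_def Suc_eq_plus1 empty_iff order_refl)
  have "A \<inter> (R - {Min R}) = A \<inter> R - {Min R}" by auto
  then have A: "card (A \<inter> R \<inter> {..x}) \<le> Suc (card (A \<inter> (R - {Min R}) \<inter> {..x}))"
    using card_prefix_remove_Min[OF assms(1) x(1), of "A \<inter> R"] by simp
  have "x \<noteq> Min R"
  proof
    assume "x = Min R"
    then have "A \<inter> R \<inter> {..x} \<subseteq> {x}"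
      using assms(1) by (auto simp: Min_le_iff) (metis Min_le antisym)
    then have "card (A \<inter> R \<inter> {..x}) \<le> 1" using card_mono[of "{x}"] by fastforce
    then show False using x(2) R by linarith
  qed
  then show ?thesis unfolding reach_def using x A R by (intro bexI[of _ x]) auto
qed

lemma card_nsets_split:
  assumes "finite M" and "r \<in> M"
  shows "card {A \<in> nsets M (Suc a). P A} =
    card {A \<in> nsets (M - {r}) a. P (insert r A)} + card {A \<in> nsets (M - {r}) (Suc a). P A}"
proof -
  let ?X = "{A \<in> nsets (M - {r}) a. P (insert r A)}"
  let ?Y = "{A \<in> nsets (M - {r}) (Suc a). P A}"
  have fin: "finite ?X" "finite ?Y" using assms by (auto simp: finite_imp_finite_nsets)
  have "{A \<in> nsets M (Suc a). P A} = insert r ` ?X \<union> ?Y" (is "?L = ?R")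
  proof
    show "?R \<subseteq> ?L" using assms by (auto simp: nsets_def card_insert_if)
    show "?L \<subseteq> ?R"
    proof
      fix A assume A: "A \<in> ?L"
      show "A \<in> ?R"
      proof (cases "r \<in> A")
        case True
        then have "A - {r} \<in> ?X" "A = insert r (A - {r})"
          using A by (auto simp: nsets_def insert_absorb)
        then show ?thesis by blast
      qed (use A in \<open>auto simp: nsets_def\<close>)
    qed
  qed
  moreover have "card (insert r ` ?X) = card ?X"
    by (rule card_image) (auto simp: inj_on_def nsets_def)
  moreover have "insert r ` ?X \<inter> ?Y = {}" by (auto simp: nsets_def)
  ultimately show ?thesis using fin by (simp add: card_Un_disjoint)
qed

text \<open>
  This is the bound of the reflection principle, obtained by recursion over the first step, which
  turns it into Pascal's rule. Points of \<open>M - R\<close> are free: they contribute to the size of \<open>A\<close> but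
  not to the path, and the same recursion removes them.
\<close>

lemma card_reach_le:
  assumes "finite M" and "R \<subseteq> M"
  shows "card {A \<in> nsets M (Suc s + d). reach (Suc s) R A} \<le> card M choose d"
  using assms
proof (induction "card M" arbitrary: M R s d)
  case 0
  then show ?case by (auto simp: reach_def)
next
  case (Suc m)
  have finR: "finite R" using Suc.prems finite_subset by blast
  have step: "card {A \<in> nsets M (Suc s + d). reach (Suc s) R A} \<le> card M choose d"
    if "r \<in> M"
      and "card {A \<in> nsets (M - {r}) (s + d). reach (Suc s) R (insert r A)} \<le> x"
      and "card {A \<in> nsets (M - {r}) (Suc (s + d)). reach (Suc s) R A} \<le> y"
      and "x + y \<le> card M choose d" for r x y
    using that card_nsets_split[OF Suc.prems(1) \<open>r \<in> M\<close>, of "s + d" "reach (Suc s) R"] by simp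
  have finr: "finite {A \<in> nsets (M - {r}) a. P A}" for r a P
    using Suc.prems(1) by (auto simp: finite_imp_finite_nsets)
  have none: "card {A \<in> nsets M' a. P A} = 0" if "\<And>A. A \<in> nsets M' a \<Longrightarrow> \<not> P A" for M' :: "nat set" and a P
    using that by (metis (no_types, lifting) card.empty empty_Collect_eq)
  have cardM: "card M choose d = (m choose d) + (if d = 0 then 0 else m choose (d - 1))"
    by (cases d) (simp_all add: Suc.hyps(2)[symmetric])
  have fin_m: "card (M - {r}) = m" if "r \<in> M" for r
    using that Suc by simp
  show ?case
  proof (cases "R = M")
    case False
    then obtain b where b: "b \<in> M" "b \<notin> R" "R \<subseteq> M - {b}" using Suc.prems by auto
    have eq: "reach (Suc s) R (insert b A) = reach (Suc s) R A" for A
      by (rule reach_cong) (use b in auto)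
    have y: "card {A \<in> nsets (M - {b}) (Suc (s + d)). reach (Suc s) R A} \<le> m choose d"
      using Suc.hyps(1)[of "M - {b}" R s d] fin_m[OF b(1)] Suc.prems b by simp
    have x: "card {A \<in> nsets (M - {b}) (s + d). reach (Suc s) R (insert b A)}
        \<le> (if d = 0 then 0 else m choose (d - 1))"
    proof (cases d)
      case 0
      have "\<not> reach (Suc s) R A" if "A \<in> nsets (M - {b}) s" for A
      proof
        assume "reach (Suc s) R A"
        then have "Suc s \<le> card (A \<inter> R)" using reach_le_card finR by blast
        also have "\<dots> \<le> card A" using that by (intro card_mono) (auto simp: nsets_def)
        finally show False using that by (auto simp: nsets_def)
      qed
      then show ?thesis using none 0 eq by (simp add: none)
    next
      case (Suc d')
      then show ?thesis
        using Suc.hyps(1)[of "M - {b}" R s d'] fin_m[OF b(1)] Suc.prems b eq by simp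
    qed
    show ?thesis by (rule step[OF b(1) x y]) (use cardM in simp)
  next
    case True
    define r where "r = Min R"
    have "R \<noteq> {}" using True Suc.hyps(2) by auto
    then have r: "r \<in> M" "r \<in> R" using True finR by (auto simp: r_def)
    have x: "card {A \<in> nsets (M - {r}) (s + d). reach (Suc s) R (insert r A)} \<le> m choose d"
    proof (cases s)
      case 0
      have "card {A \<in> nsets (M - {r}) (s + d). reach (Suc s) R (insert r A)} \<le> card (nsets (M - {r}) d)"
        by (rule card_mono) (use 0 Suc.prems in \<open>auto simp: finite_imp_finite_nsets\<close>)
      then show ?thesis using fin_m[OF r(1)] by (simp add: card_nsets)
    next
      case (Suc s')
      have "reach (Suc s') (R - {r}) A" if "reach (Suc s) R (insert r A)" for A
      proof -
        have "reach (Suc s') (R - {r}) (insert r A)"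
          using reach_Min_in[OF finR, of s' "insert r A"] that Suc by (simp add: r_def)
        then show ?thesis by (rule reach_cong[THEN iffD1, rotated]) auto
      qed
      then have "card {A \<in> nsets (M - {r}) (s + d). reach (Suc s) R (insert r A)} \<le>
          card {A \<in> nsets (M - {r}) (Suc s' + d). reach (Suc s') (R - {r}) A}"
        using Suc by (intro card_mono finr) auto
      also have "\<dots> \<le> m choose d"
        using Suc.hyps(1)[of "M - {r}" "R - {r}" s' d] fin_m[OF r(1)] Suc.prems True by simp
      finally show ?thesis .
    qed
    have red: "reach (Suc (Suc s)) (R - {r}) A" if "reach (Suc s) R A" "A \<in> nsets (M - {r}) a" for A a
      using reach_Min_notin[OF finR that(1)] that(2) by (auto simp: r_def nsets_def)
    have y: "card {A \<in> nsets (M - {r}) (Suc (s + d)). reach (Suc s) R A}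
        \<le> (if d = 0 then 0 else m choose (d - 1))"
    proof (cases d)
      case 0
      have "\<not> reach (Suc s) R A" if A: "A \<in> nsets (M - {r}) (Suc s)" for A
      proof
        assume "reach (Suc s) R A"
        then have "Suc (Suc s) \<le> card (A \<inter> (R - {r}))"
          using red[OF _ A] reach_le_card finR by blast
        also have "\<dots> \<le> card A" using that by (intro card_mono) (auto simp: nsets_def)
        finally show False using that by (auto simp: nsets_def)
      qed
      then show ?thesis using none 0 by simp
    next
      case (Suc d')
      have "card {A \<in> nsets (M - {r}) (Suc (s + d)). reach (Suc s) R A} \<le>
          card {A \<in> nsets (M - {r}) (Suc (Suc s) + d'). reach (Suc (Suc s)) (R - {r}) A}"
        using Suc red by (intro card_mono finr) auto
      also have "\<dots> \<le> m choose d'"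
        using Suc.hyps(1)[of "M - {r}" "R - {r}" "Suc s" d'] fin_m[OF r(1)] Suc.prems True by simp
      finally show ?thesis using Suc by simp
    qed
    show ?thesis by (rule step[OF r(1) x y]) (use cardM in simp)
  qed
qed

text \<open>
  Height 0 is the exceptional case: an initial up step settles it at once, and after an initial down
  step the rest of the path has to climb to height 1. Each case contributes one binomial coefficient.
\<close>

lemma card_reach_0_le:
  assumes "finite M"
  shows "card {A \<in> nsets M (Suc d). reach 0 M A} \<le> 2 * ((card M - 1) choose d)"
proof (cases "M = {}")
  case True
  then show ?thesis by (simp add: reach_def)
next
  case False
  define r where "r = Min M"
  have r: "r \<in> M" using False assms by (simp add: r_def)
  have cm: "card (M - {r}) = card M - 1" using r assms by simp
  have "card {A \<in> nsets (M - {r}) d. reach 0 M (insert r A)} \<le> card (nsets (M - {r}) d)"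
    by (rule card_mono) (use assms in \<open>auto simp: finite_imp_finite_nsets\<close>)
  then have x: "card {A \<in> nsets (M - {r}) d. reach 0 M (insert r A)} \<le> (card M - 1) choose d"
    by (simp add: card_nsets cm)
  have "card {A \<in> nsets (M - {r}) (Suc d). reach 0 M A} \<le>
      card {A \<in> nsets (M - {r}) (Suc 0 + d). reach (Suc 0) (M - {r}) A}"
    using reach_Min_notin[OF assms, of 0] assms
    by (intro card_mono) (auto simp: r_def nsets_def finite_imp_finite_nsets)
  also have "\<dots> \<le> (card M - 1) choose d"
    using card_reach_le[of "M - {r}" "M - {r}" 0 d] assms cm by simp
  finally show ?thesis
    using x card_nsets_split[OF assms r, of d "reach 0 M"] by simp
qed

text \<open>
  The form in which the count is used: \<open>S\<close> is prescribed, \<open>T\<close> is forbidden, and \<open>S\<close> can be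
  removed from all members because the path does not see it.
\<close>

lemma card_family_reach_le:
  assumes V: "finite V" "\<H> \<subseteq> nsets V (card S + Suc s + d)"
    and "S \<subseteq> V" "R \<subseteq> V - (S \<union> T)"
    and \<H>: "\<And>A. A \<in> \<H> \<Longrightarrow> S \<subseteq> A \<and> A \<inter> T = {} \<and> reach (Suc s) R A"
  shows "card \<H> \<le> card (V - (S \<union> T)) choose d"
proof -
  let ?X = "{A \<in> nsets (V - (S \<union> T)) (Suc s + d). reach (Suc s) R A}"
  have S: "finite S" using assms finite_subset by blast
  have "card \<H> \<le> card ?X"
  proof (rule card_inj_on_le[of "\<lambda>A. A - S"])
    show "inj_on (\<lambda>A. A - S) \<H>"
      using \<H> by (auto simp: inj_on_def)
    show "(\<lambda>A. A - S) ` \<H> \<subseteq> ?X"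
    proof (rule image_subsetI)
      fix A assume A: "A \<in> \<H>"
      have "reach (Suc s) R (A - S)"
        by (rule reach_cong[THEN iffD1, of A]) (use \<H>[OF A] assms in auto)
      moreover have "card (A - S) = Suc s + d"
        using A V \<H>[OF A] S by (auto simp: nsets_def card_Diff_subset)
      ultimately show "A - S \<in> ?X" using A V \<H>[OF A] by (auto simp: nsets_def)
    qed
    show "finite ?X" using V by (auto simp: finite_imp_finite_nsets)
  qed
  also have "\<dots> \<le> card (V - (S \<union> T)) choose d"
    by (rule card_reach_le) (use assms in auto)
  finally show ?thesis .
qed

section \<open>Shifting\<close>

definition shift_set :: "nat \<Rightarrow> nat \<Rightarrow> nat set set \<Rightarrow> nat set \<Rightarrow> nat set" where
  "shift_set i j \<H> A =
    (if j \<in> A \<and> i \<notin> A \<and> insert i (A - {j}) \<notin> \<H> then insert i (A - {j}) else A)"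

definition shift :: "nat \<Rightarrow> nat \<Rightarrow> nat set set \<Rightarrow> nat set set" where
  "shift i j \<H> = shift_set i j \<H> ` \<H>"

definition stable :: "nat set \<Rightarrow> nat set set \<Rightarrow> bool" where
  "stable R \<H> \<longleftrightarrow>
    (\<forall>A\<in>\<H>. \<forall>i\<in>R. \<forall>j\<in>R. i < j \<longrightarrow> j \<in> A \<longrightarrow> i \<notin> A \<longrightarrow> insert i (A - {j}) \<in> \<H>)"

lemma stableD:
  "stable R \<H> \<Longrightarrow> A \<in> \<H> \<Longrightarrow> i \<in> R \<Longrightarrow> j \<in> R \<Longrightarrow> i < j \<Longrightarrow> j \<in> A \<Longrightarrow> i \<notin> A \<Longrightarrow> insert i (A - {j}) \<in> \<H>"
  unfolding stable_def by blast

lemma inj_on_shift_set: "inj_on (shift_set i j \<H>) \<H>"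
proof (rule inj_onI)
  fix A B assume AB: "A \<in> \<H>" "B \<in> \<H>" "shift_set i j \<H> A = shift_set i j \<H> B"
  show "A = B"
  proof (cases "shift_set i j \<H> A = A \<or> shift_set i j \<H> B = B")
    case True
    then show ?thesis using AB by (auto simp: shift_set_def split: if_splits)
  next
    case False
    then have j: "j \<in> A" "j \<in> B" "i \<notin> A" "i \<notin> B" and eq: "insert i (A - {j}) = insert i (B - {j})"
      using AB(3) by (auto simp: shift_set_def split: if_splits)
    have "A - {j} = B - {j}"
      using eq j insert_ident[of i "A - {j}" "B - {j}"] by simp
    then show ?thesis using j by (metis insert_Diff)
  qed
qed

lemma card_shift: "card (shift i j \<H>) = card \<H>"
  unfolding shift_def by (rule card_image[OF inj_on_shift_set])

lemma card_shift_filter: "card {A \<in> shift i j \<H>. P A} = card {A \<in> \<H>. P (shift_set i j \<H> A)}"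
proof -
  have "{A \<in> shift i j \<H>. P A} = shift_set i j \<H> ` {A \<in> \<H>. P (shift_set i j \<H> A)}"
    by (auto simp: shift_def)
  then show ?thesis
    by (simp add: card_image inj_on_subset[OF inj_on_shift_set])
qed

lemma shift_subset_nsets:
  assumes "\<H> \<subseteq> nsets M k" and "i \<in> M"
  shows "shift i j \<H> \<subseteq> nsets M k"
proof -
  have "shift_set i j \<H> A \<in> nsets M k" if "A \<in> nsets M k" for A
  proof -
    have "finite A" "card A = k" "A \<subseteq> M" using that by (auto simp: nsets_def)
    moreover have "card (insert i (A - {j})) = card A" if "j \<in> A" "i \<notin> A"
      using that \<open>finite A\<close> card_Suc_Diff1[of A j] by simp
    ultimately show ?thesis using assms(2) by (auto simp: shift_set_def nsets_def)
  qed
  then show ?thesis using assms(1) by (auto simp: shift_def)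
qed

lemma cross_intersecting_sym: "cross_intersecting \<F> \<G> \<Longrightarrow> cross_intersecting \<G> \<F>"
  by (auto simp: cross_intersecting_def Int_commute)

lemma cross_intersecting_shift:
  assumes "cross_intersecting \<F> \<G>"
  shows "cross_intersecting (shift i j \<F>) (shift i j \<G>)"
proof -
  have meet: "A \<inter> B \<noteq> {}" if "A \<in> \<F>" "B \<in> \<G>" for A B
    using assms that by (auto simp: cross_intersecting_def)
  have moved: "insert i (A - {j}) \<inter> B \<noteq> {}"
    if H: "\<And>A B. A \<in> \<F>' \<Longrightarrow> B \<in> \<G>' \<Longrightarrow> A \<inter> B \<noteq> {}" and "A \<in> \<F>'" "B \<in> \<G>'" "j \<in> A" "i \<notin> A"
      and "shift_set i j \<G>' B = B" for A B :: "nat set" and \<F>' \<G>'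
  proof (cases "i \<in> B \<or> j \<notin> B")
    case True
    then show ?thesis using H[of A B] that by auto
  next
    case False
    then have B': "insert i (B - {j}) \<in> \<G>'"
      using that by (auto simp: shift_set_def split: if_splits)
    then show ?thesis using H[OF \<open>A \<in> \<F>'\<close> B'] that by auto
  qed
  show ?thesis
    unfolding cross_intersecting_def shift_def
  proof safe
    fix A B assume A: "A \<in> \<F>" and B: "B \<in> \<G>" and dis: "shift_set i j \<F> A \<inter> shift_set i j \<G> B = {}"
    have cases: "shift_set i j \<H> C = C \<or> j \<in> C \<and> i \<notin> C \<and> shift_set i j \<H> C = insert i (C - {j})" for \<H> C
      by (auto simp: shift_set_def)
    consider "shift_set i j \<F> A = A" "shift_set i j \<G> B = B"
      | "shift_set i j \<F> A = A" "j \<in> B" "i \<notin> B" "shift_set i j \<G> B = insert i (B - {j})"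
      | "j \<in> A" "i \<notin> A" "shift_set i j \<F> A = insert i (A - {j})" "shift_set i j \<G> B = B"
      | "i \<in> shift_set i j \<F> A" "i \<in> shift_set i j \<G> B"
      using cases[of \<F> A] cases[of \<G> B] by auto
    then show False
    proof cases
      case 1 then show ?thesis using meet[OF A B] dis by simp
    next
      case 2
      then show ?thesis using moved[of \<G> \<F> B A] meet A B dis by (metis inf_commute)
    next
      case 3
      then show ?thesis using moved[of \<F> \<G> A B] meet A B dis by metis
    next
      case 4 then show ?thesis using dis by blast
    qed
  qed
qed

definition weight :: "nat set set \<Rightarrow> nat" where
  "weight \<H> = (\<Sum>A\<in>\<H>. \<Sum>A)"

lemma sum_shift_set:
  assumes "finite A" and "i < j"
  shows "\<Sum>(shift_set i j \<H> A) \<le> \<Sum>A"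
    and "shift_set i j \<H> A \<noteq> A \<Longrightarrow> \<Sum>(shift_set i j \<H> A) < \<Sum>A"
proof -
  have *: "\<Sum>(insert i (A - {j})) < \<Sum>A" if "j \<in> A" "i \<notin> A"
    using that assms by (simp add: sum.remove[of A j])
  show "shift_set i j \<H> A \<noteq> A \<Longrightarrow> \<Sum>(shift_set i j \<H> A) < \<Sum>A"
    using * by (metis shift_set_def)
  then show "\<Sum>(shift_set i j \<H> A) \<le> \<Sum>A" by (cases "shift_set i j \<H> A = A") auto
qed

text \<open>
  A proper shift replaces some \<open>j\<close> by a smaller \<open>i\<close>, so the weight is the potential that makes
  repeated shifting stop.
\<close>

lemma weight_shift:
  assumes "finite \<H>" and "\<And>A. A \<in> \<H> \<Longrightarrow> finite A" and "i < j"
  shows "weight (shift i j \<H>) \<le> weight \<H>"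
    and "\<not> stable {i, j} \<H> \<Longrightarrow> weight (shift i j \<H>) < weight \<H>"
proof -
  have eq: "weight (shift i j \<H>) = (\<Sum>A\<in>\<H>. \<Sum>(shift_set i j \<H> A))"
    unfolding weight_def shift_def by (simp add: sum.reindex[OF inj_on_shift_set])
  show "weight (shift i j \<H>) \<le> weight \<H>"
    unfolding eq unfolding weight_def by (rule sum_mono) (use assms sum_shift_set in auto)
  assume "\<not> stable {i, j} \<H>"
  then obtain A where "A \<in> \<H>" "j \<in> A" "i \<notin> A" "insert i (A - {j}) \<notin> \<H>"
    using \<open>i < j\<close> by (auto simp: stable_def)
  then have A: "A \<in> \<H>" "shift_set i j \<H> A \<noteq> A" by (auto simp: shift_set_def)
  show "weight (shift i j \<H>) < weight \<H>"
    unfolding eq unfolding weight_def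
    using assms(1)
  proof (rule sum_strict_mono_ex1)
    show "\<forall>B\<in>\<H>. \<Sum>(shift_set i j \<H> B) \<le> \<Sum>B"
      using assms sum_shift_set(1) by simp
    show "\<exists>B\<in>\<H>. \<Sum>(shift_set i j \<H> B) < \<Sum>B"
      using sum_shift_set(2)[OF assms(2) assms(3), of A \<H>] A by blast
  qed
qed

text \<open>
  Shifting as far as an arbitrary constraint \<open>P\<close> permits. It is applied below both without a
  constraint on degrees and with one; in the latter case some shifts are blocked.
\<close>

lemma exists_extremal_pair:
  fixes P :: "nat set set \<Rightarrow> nat set set \<Rightarrow> bool"
  assumes "P \<F>\<^sub>0 \<G>\<^sub>0"
    and fin: "\<And>\<F> \<G>. P \<F> \<G> \<Longrightarrow> \<F> \<subseteq> nsets V a \<and> \<G> \<subseteq> nsets V b" and "finite V"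
  obtains \<F> \<G> where "P \<F> \<G>"
    and "\<And>i j. i < j \<Longrightarrow> P (shift i j \<F>) (shift i j \<G>) \<Longrightarrow> stable {i, j} \<F> \<and> stable {i, j} \<G>"
proof -
  define w where "w = (\<lambda>(\<F>, \<G>). weight \<F> + weight \<G>)"
  obtain p where p: "case p of (\<F>, \<G>) \<Rightarrow> P \<F> \<G>" "\<And>q. (case q of (\<F>, \<G>) \<Rightarrow> P \<F> \<G>) \<Longrightarrow> w p \<le> w q"
    using ex_has_least_nat[of "\<lambda>p. case p of (\<F>, \<G>) \<Rightarrow> P \<F> \<G>" "(\<F>\<^sub>0, \<G>\<^sub>0)" w] assms(1) by auto
  obtain \<F> \<G> where FG: "p = (\<F>, \<G>)" by fastforce
  have P: "P \<F> \<G>" using p FG by simp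
  have fF: "finite \<F>" "finite \<G>"
    using fin[OF P] \<open>finite V\<close> by (meson finite_imp_finite_nsets finite_subset)+
  have fA: "\<And>A. A \<in> \<F> \<Longrightarrow> finite A" "\<And>A. A \<in> \<G> \<Longrightarrow> finite A"
    using fin[OF P] by (auto simp: nsets_def)
  have "stable {i, j} \<F> \<and> stable {i, j} \<G>" if "i < j" "P (shift i j \<F>) (shift i j \<G>)" for i j
  proof (rule ccontr)
    assume "\<not> (stable {i, j} \<F> \<and> stable {i, j} \<G>)"
    then have "weight (shift i j \<F>) + weight (shift i j \<G>) < weight \<F> + weight \<G>"
      using weight_shift[OF fF(1) fA(1) \<open>i < j\<close>] weight_shift[OF fF(2) fA(2) \<open>i < j\<close>] by linarith
    moreover have "w p \<le> w (shift i j \<F>, shift i j \<G>)" using p(2) that by simp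
    ultimately show False using FG by (simp add: w_def)
  qed
  then show ?thesis using that P by blast
qed

section \<open>Cross-intersecting families with a stable member\<close>

text \<open>
  If every initial segment had room for the elements of \<open>A\<close> and \<open>B\<close> together, then there would be a
  gap below the first common element \<open>z\<close>, that is, a point \<open>y < z\<close> outside \<open>A \<union> B\<close>. Moving \<open>z\<close>
  down to \<open>y\<close> in \<open>B\<close> keeps the inequality, since the sets are disjoint below \<open>z\<close>, and leaves fewer
  common elements; eventually \<open>A\<close> would miss a member of \<open>\<G>\<close>. Only \<open>\<G>\<close> has to be stable, and only
  on a part \<open>R\<close> of the ground set that contains \<open>A \<inter> B\<close>.
\<close>

lemma stable_cross_prefix:
  assumes "finite R" and "stable R \<G>" and meet: "\<And>B. B \<in> \<G> \<Longrightarrow> A \<inter> B \<noteq> {}"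
    and "B \<in> \<G>" and "finite A" and "A \<inter> B \<subseteq> R"
  shows "\<exists>x\<in>R. card (R \<inter> {..x}) < card (A \<inter> R \<inter> {..x}) + card (B \<inter> R \<inter> {..x})"
  using assms(4,6)
proof (induction "card (A \<inter> B)" arbitrary: B rule: less_induct)
  case less
  show ?case
  proof (rule ccontr)
    assume "\<not> ?thesis"
    then have small: "card (A \<inter> R \<inter> {..x}) + card (B \<inter> R \<inter> {..x}) \<le> card (R \<inter> {..x})" if "x \<in> R" for x
      using that by (simp add: not_less)
    define z where "z = Min (A \<inter> B)"
    have fin: "finite (A \<inter> B)" using assms by blast
    have zAB: "z \<in> A" "z \<in> B" using Min_in[OF fin meet[OF less.prems(1)]] by (auto simp: z_def)
    have zR: "z \<in> R" using less.prems(2) zAB by auto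
    have zmin: "x \<notin> A \<or> x \<notin> B" if "x < z" for x
      using that Min_le[OF fin, of x] by (auto simp: z_def)
    let ?U = "(A \<union> B) \<inter> R \<inter> {..z}"
    have finR: "finite (X \<inter> R \<inter> Y)" for X Y using assms(1) by auto
    have "card ?U + card (A \<inter> B \<inter> R \<inter> {..z}) = card (A \<inter> R \<inter> {..z}) + card (B \<inter> R \<inter> {..z})"
    proof -
      have "(A \<inter> R \<inter> {..z}) \<union> (B \<inter> R \<inter> {..z}) = ?U"
        and "(A \<inter> R \<inter> {..z}) \<inter> (B \<inter> R \<inter> {..z}) = A \<inter> B \<inter> R \<inter> {..z}" by auto
      then show ?thesis using card_Un_Int[OF finR finR, of A "{..z}" B "{..z}"] by simp
    qed
    moreover have "card (A \<inter> B \<inter> R \<inter> {..z}) > 0"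
      using zAB zR finR[of "A \<inter> B"] by (auto simp: card_gt_0_iff)
    ultimately have "card ?U < card (R \<inter> {..z})" using small[OF zR] by linarith
    then have "\<not> R \<inter> {..z} \<subseteq> ?U"
      using card_mono[OF finR[of "A \<union> B" "{..z}"]] by (auto simp: not_less[symmetric])
    then obtain y where y: "y \<in> R" "y \<le> z" "y \<notin> A" "y \<notin> B" by auto
    have yz: "y < z" using y zAB by (metis le_neq_implies_less)
    define B' where "B' = insert y (B - {z})"
    have B': "B' \<in> \<G>" unfolding B'_def
      using stableD[OF assms(2) less.prems(1) y(1) zR yz] zAB y by simp
    have "A \<inter> B' \<subset> A \<inter> B" using zAB y by (auto simp: B'_def)
    then have "card (A \<inter> B') < card (A \<inter> B)" "A \<inter> B' \<subseteq> R"
      using fin less.prems(2) by (auto intro: psubset_card_mono)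
    then obtain x where x: "x \<in> R"
      "card (R \<inter> {..x}) < card (A \<inter> R \<inter> {..x}) + card (B' \<inter> R \<inter> {..x})"
      using less.hyps[of B'] B' by blast
    show False
    proof (cases "x < z")
      case True
      have "A \<inter> R \<inter> {..x} \<inter> (B' \<inter> R \<inter> {..x}) = {}" using zmin True y by (auto simp: B'_def)
      then have "card (A \<inter> R \<inter> {..x}) + card (B' \<inter> R \<inter> {..x}) = card ((A \<inter> R \<inter> {..x}) \<union> (B' \<inter> R \<inter> {..x}))"
        using finR by (subst card_Un_disjoint) auto
      also have "\<dots> \<le> card (R \<inter> {..x})" using assms(1) by (intro card_mono) auto
      finally show False using x by simp
    next
      case False
      then have "B' \<inter> R \<inter> {..x} = insert y ((B \<inter> R \<inter> {..x}) - {z})"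
        using y yz by (auto simp: B'_def)
      then have "card (B' \<inter> R \<inter> {..x}) = card (B \<inter> R \<inter> {..x})"
        using finR[of B "{..x}"] False zAB zR y
          card_Suc_Diff1[of "B \<inter> R \<inter> {..x}" z] by simp
      then show False using x small by fastforce
    qed
  qed
qed

lemma stable_cross_reach:
  assumes "finite R" and "stable R \<G>" and "\<And>B. B \<in> \<G> \<Longrightarrow> A \<inter> B \<noteq> {}"
    and "B \<in> \<G>" and "finite A" and "A \<inter> B \<subseteq> R"
    and "\<not> reach s R A" and "s + t = 3"
  shows "reach t R B"
proof -
  obtain x where x: "x \<in> R" "card (R \<inter> {..x}) < card (A \<inter> R \<inter> {..x}) + card (B \<inter> R \<inter> {..x})"
    using stable_cross_prefix[OF assms(1-6)] by blast
  have "2 * card (A \<inter> R \<inter> {..x}) < card (R \<inter> {..x}) + s"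
    using assms(7) x(1) by (auto simp: reach_def not_le)
  then have "card (R \<inter> {..x}) + t \<le> 2 * card (B \<inter> R \<inter> {..x})" using x(2) assms(8) by linarith
  then show ?thesis using x(1) by (auto simp: reach_def)
qed

lemma stable_pairs: "(\<And>i j. i \<in> R \<Longrightarrow> j \<in> R \<Longrightarrow> i < j \<Longrightarrow> stable {i, j} \<H>) \<Longrightarrow> stable R \<H>"
  unfolding stable_def by blast

text \<open>
  After shifting, \<open>\<A>\<close> is still too large for all of its paths to touch height 0, and a path that
  stays below it forces every member of the other family to reach height 3.
\<close>

lemma card_le_of_cross_intersecting:
  assumes "finite M" and "\<A> \<subseteq> nsets M (Suc d)" and "\<B> \<subseteq> nsets M (d + 3)"
    and "cross_intersecting \<A> \<B>" and "2 * ((card M - 1) choose d) < card \<A>"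
  shows "card \<B> \<le> card M choose d"
proof -
  let ?P = "\<lambda>\<F> \<G>. \<F> \<subseteq> nsets M (Suc d) \<and> \<G> \<subseteq> nsets M (d + 3) \<and> cross_intersecting \<F> \<G>
    \<and> card \<F> = card \<A> \<and> card \<G> = card \<B>"
  obtain \<F> \<G> where P: "?P \<F> \<G>"
    and st: "\<And>i j. i < j \<Longrightarrow> ?P (shift i j \<F>) (shift i j \<G>) \<Longrightarrow> stable {i, j} \<F> \<and> stable {i, j} \<G>"
    by (rule exists_extremal_pair[of ?P \<A> \<B> M "Suc d" "d + 3"]) (use assms in auto)
  have "stable M \<G>"
    by (rule stable_pairs) (use st P in \<open>simp add: shift_subset_nsets cross_intersecting_shift card_shift\<close>)
  have "\<exists>A\<in>\<F>. \<not> reach 0 M A"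
  proof (rule ccontr)
    assume "\<not> ?thesis"
    then have "\<F> \<subseteq> {A \<in> nsets M (Suc d). reach 0 M A}" using P by auto
    then have "card \<F> \<le> card {A \<in> nsets M (Suc d). reach 0 M A}"
      using assms(1) by (intro card_mono) (auto simp: finite_imp_finite_nsets)
    then show False using card_reach_0_le[OF assms(1), of d] assms(5) P by linarith
  qed
  then obtain A where A: "A \<in> \<F>" "\<not> reach 0 M A" by blast
  have "reach 3 M B" if "B \<in> \<G>" for B
    by (rule stable_cross_reach[OF assms(1) \<open>stable M \<G>\<close>, of A B 0])
      (use A that P in \<open>auto simp: cross_intersecting_def nsets_def\<close>)
  then have "\<G> \<subseteq> {B \<in> nsets M (Suc 2 + d). reach (Suc 2) M B}"
    using P by (auto simp: eval_nat_numeral)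
  then have "card \<G> \<le> card {B \<in> nsets M (Suc 2 + d). reach (Suc 2) M B}"
    using assms(1) by (intro card_mono) (auto simp: finite_imp_finite_nsets)
  then show ?thesis using card_reach_le[OF assms(1) order_refl, of 2 d] P by linarith
qed

section \<open>Pairs of families with bounded degrees\<close>

lemma choose_Suc_le_double:
  assumes "2 * j \<le> m"
  shows "Suc m choose j \<le> 2 * (m choose j)"
proof (cases j)
  case (Suc i)
  have "m choose i \<le> m choose j" using Suc assms by (intro binomial_mono) auto
  then show ?thesis using Suc by simp
qed simp

lemma choose_Suc_less_double:
  assumes "2 * j \<le> m"
  shows "Suc m choose j < 2 * (m choose j)"
proof (cases j)
  case (Suc i)
  have "m choose i < m choose j" using Suc assms by (intro binomial_strict_mono) auto
  then show ?thesis using Suc by simp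
qed simp

text \<open>
  With \<open>|\<H>| / 2 - s\<close> as the degree bound, a shift within the pair \<open>e\<close> can break the bound only if
  \<open>e\<close> is congested, since afterwards no degree in \<open>e\<close> exceeds the number of members that met \<open>e\<close>.
\<close>

definition congested :: "nat set set \<Rightarrow> real \<Rightarrow> nat set \<Rightarrow> bool" where
  "congested \<H> s e \<longleftrightarrow> real (card \<H>) / 2 - s < real (card {A \<in> \<H>. A \<inter> e \<noteq> {}})"

lemma card_filter_disj_le:
  assumes "finite \<H>" and "\<And>A. A \<in> \<H> \<Longrightarrow> P A \<Longrightarrow> Q A \<or> R A"
  shows "card {A \<in> \<H>. P A} \<le> card {A \<in> \<H>. Q A} + card {A \<in> \<H>. R A}"
proof -
  have "card {A \<in> \<H>. P A} \<le> card ({A \<in> \<H>. Q A} \<union> {A \<in> \<H>. R A})"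
    using assms by (intro card_mono) auto
  also have "\<dots> \<le> card {A \<in> \<H>. Q A} + card {A \<in> \<H>. R A}" by (rule card_Un_le)
  finally show ?thesis .
qed

text \<open>
  The situation to be refuted. In the application \<open>s = \<epsilon> |\<F>|\<close> and \<open>t = \<epsilon> |\<G>|\<close>, which makes all
  later estimates linear; the condition \<open>2 k \<le> n\<close> follows from the sizes of the families.
  It bounds binomial coefficients close to \<open>N\<close> by multiples of \<open>N\<close>.
\<close>

locale bounded_pair =
  fixes n k :: nat and \<F> \<G> :: "nat set set" and s t :: real
  assumes k3: "3 \<le> k" and kn: "2 * k \<le> n"
    and F_sub: "\<F> \<subseteq> nsets {1..n} k" and G_sub: "\<G> \<subseteq> nsets {1..n} k"
    and cross: "cross_intersecting \<F> \<G>"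
    and F_degree: "\<And>v. v \<in> {1..n} \<Longrightarrow> real (card {A \<in> \<F>. v \<in> A}) \<le> real (card \<F>) / 2 - s"
    and G_degree: "\<And>v. v \<in> {1..n} \<Longrightarrow> real (card {A \<in> \<G>. v \<in> A}) \<le> real (card \<G>) / 2 - t"
    and s_ge: "real ((n - 3) choose (k - 3)) \<le> s" and F_large: "58 * s \<le> real (card \<F>)"
    and t_ge: "real ((n - 3) choose (k - 3)) \<le> t" and G_large: "58 * t \<le> real (card \<G>)"
begin

abbreviation N :: nat where "N \<equiv> (n - 3) choose (k - 3)"

lemma bounded_pair_swap: "bounded_pair n k \<G> \<F> t s"
  using k3 kn F_sub G_sub cross F_degree G_degree s_ge F_large t_ge G_large
  by unfold_locales (auto intro: cross_intersecting_sym)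

lemma N_pos: "0 < N"
  using k3 kn by (simp add: zero_less_binomial)

lemma choose_n2: "(n - 2) choose (k - 3) < 2 * N"
proof -
  have "Suc (n - 3) = n - 2" using k3 kn by simp
  then show ?thesis using choose_Suc_less_double[of "k - 3" "n - 3"] k3 kn by simp
qed

lemma choose_n1: "(n - 1) choose (k - 3) < 4 * N"
proof -
  have "Suc (n - 2) = n - 1" using k3 kn by simp
  then have "(n - 1) choose (k - 3) \<le> 2 * ((n - 2) choose (k - 3))"
    using choose_Suc_le_double[of "k - 3" "n - 2"] k3 kn by simp
  then show ?thesis using choose_n2 by linarith
qed

lemma choose_le_N: "m \<le> n - 3 \<Longrightarrow> m choose (k - 3) \<le> N"
  by (rule binomial_right_mono)

lemma finite_F: "finite \<F>"
  using F_sub by (meson finite_atLeastAtMost finite_imp_finite_nsets finite_subset)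

lemma finite_G: "finite \<G>"
  by (rule bounded_pair.finite_F[OF bounded_pair_swap])

lemma F_elem: "A \<in> \<F> \<Longrightarrow> A \<subseteq> {1..n} \<and> finite A \<and> card A = k"
  using F_sub by (auto simp: nsets_def)

lemma card_split: "card {A \<in> \<F>. P A} + card {A \<in> \<F>. \<not> P A} = card \<F>"
proof -
  have "\<F> = {A \<in> \<F>. P A} \<union> {A \<in> \<F>. \<not> P A}" by auto
  moreover have "card ({A \<in> \<F>. P A} \<union> {A \<in> \<F>. \<not> P A}) = card {A \<in> \<F>. P A} + card {A \<in> \<F>. \<not> P A}"
    by (rule card_Un_disjoint) (use finite_F in auto)
  ultimately show ?thesis by simp
qed

text \<open>
  By the degree bounds at least \<open>2 t \<ge> 2 N\<close> members of \<open>\<G>\<close> avoid both \<open>x\<close> and \<open>y\<close>. They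
  cross-intersect the members of \<open>\<F>\<close> through \<open>x\<close> and \<open>y\<close> with these two points removed, so the
  latter cannot be numerous.
\<close>

lemma codegree:
  assumes x: "x \<in> {1..n}" and y: "y \<in> {1..n}" and "x \<noteq> y"
  shows "card {A \<in> \<F>. x \<in> A \<and> y \<in> A} \<le> 2 * N"
proof (rule ccontr)
  assume large: "\<not> ?thesis"
  interpret swap: bounded_pair n k \<G> \<F> t s by (rule bounded_pair_swap)
  define M where "M = {1..n} - {x, y}"
  define d where "d = k - 3"
  have k: "k = d + 3" using k3 by (simp add: d_def)
  have M: "finite M" "card M = n - 2" "card M - 1 = n - 3" using assms by (auto simp: M_def)
  define \<A> where "\<A> = (\<lambda>A. A - {x, y}) ` {A \<in> \<F>. x \<in> A \<and> y \<in> A}"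
  define \<B> where "\<B> = {B \<in> \<G>. \<not> (x \<in> B \<or> y \<in> B)}"
  have "card \<A> = card {A \<in> \<F>. x \<in> A \<and> y \<in> A}"
    unfolding \<A>_def by (rule card_image) (auto simp: inj_on_def)
  moreover have "\<A> \<subseteq> nsets M (Suc d)"
    using F_elem \<open>x \<noteq> y\<close> k by (auto simp: \<A>_def M_def nsets_def card_Diff_subset)
  moreover have "\<B> \<subseteq> nsets M (d + 3)"
    using swap.F_elem k by (auto simp: \<B>_def M_def nsets_def)
  moreover have "cross_intersecting \<A> \<B>"
    using cross by (fastforce simp: \<A>_def \<B>_def cross_intersecting_def)
  ultimately have "card \<B> \<le> (n - 2) choose d"
    using card_le_of_cross_intersecting[of M \<A> d \<B>] M large by (simp add: d_def)
  then have "card \<B> < 2 * N" using choose_n2 by (simp add: d_def)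
  moreover have "card {B \<in> \<G>. x \<in> B \<or> y \<in> B} \<le> card {B \<in> \<G>. x \<in> B} + card {B \<in> \<G>. y \<in> B}"
    by (rule card_filter_disj_le[OF finite_G]) auto
  moreover have "card {B \<in> \<G>. x \<in> B \<or> y \<in> B} + card \<B> = card \<G>"
    unfolding \<B>_def by (rule swap.card_split)
  ultimately show False using G_degree[OF x] G_degree[OF y] t_ge by linarith
qed

lemma card_meet_both:
  assumes "e \<subseteq> {1..n}" "e' \<subseteq> {1..n}" "card e \<le> 2" "card e' \<le> 2" "e \<inter> e' = {}"
  shows "card {A \<in> \<F>. A \<inter> e \<noteq> {} \<and> A \<inter> e' \<noteq> {}} \<le> 8 * N"
proof -
  have fin: "finite (e \<times> e')" using assms finite_subset by blast
  have "{A \<in> \<F>. A \<inter> e \<noteq> {} \<and> A \<inter> e' \<noteq> {}} = (\<Union>(x, y)\<in>e \<times> e'. {A \<in> \<F>. x \<in> A \<and> y \<in> A})"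
    by auto
  also have "card \<dots> \<le> (\<Sum>p\<in>e \<times> e'. card (case p of (x, y) \<Rightarrow> {A \<in> \<F>. x \<in> A \<and> y \<in> A}))"
    by (rule card_UN_le[OF fin])
  also have "\<dots> \<le> (\<Sum>p\<in>e \<times> e'. 2 * N)"
  proof (rule sum_mono)
    fix p assume "p \<in> e \<times> e'"
    then obtain x y where "p = (x, y)" "x \<in> e" "y \<in> e'" by blast
    moreover from this have "x \<in> {1..n}" "y \<in> {1..n}" "x \<noteq> y" using assms by blast+
    ultimately show "card (case p of (x, y) \<Rightarrow> {A \<in> \<F>. x \<in> A \<and> y \<in> A}) \<le> 2 * N"
      using codegree by simp
  qed
  also have "\<dots> = card e * card e' * (2 * N)" by (simp add: card_cartesian_product)
  also have "\<dots> \<le> 2 * 2 * (2 * N)" by (intro mult_le_mono) (use assms in auto)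
  finally show ?thesis by simp
qed

lemma card_meet_add:
  assumes "e \<subseteq> {1..n}" "e' \<subseteq> {1..n}" "card e \<le> 2" "card e' \<le> 2" "e \<inter> e' = {}"
  shows "card {A \<in> \<F>. A \<inter> e \<noteq> {}} + card {A \<in> \<F>. A \<inter> e' \<noteq> {}} \<le>
    card ({A \<in> \<F>. A \<inter> e \<noteq> {}} \<union> {A \<in> \<F>. A \<inter> e' \<noteq> {}}) + 8 * N"
proof -
  let ?h = "\<lambda>e. {A \<in> \<F>. A \<inter> e \<noteq> {}}"
  have "?h e \<inter> ?h e' = {A \<in> \<F>. A \<inter> e \<noteq> {} \<and> A \<inter> e' \<noteq> {}}" by auto
  then show ?thesis
    using card_Un_Int[of "?h e" "?h e'"] finite_F card_meet_both[OF assms] by simp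
qed

text \<open>
  Three congested pairs account for more than \<open>3 |\<F>| / 2 - 3 s\<close> incidences. At most \<open>24 N\<close> of these
  are repetitions, since each two pairs have at most \<open>8 N\<close> common members, and
  \<open>|\<F>| / 2 - 3 s \<ge> 26 s\<close>.
\<close>

lemma no_three_congested:
  assumes "\<And>e. e \<in> {e1, e2, e3} \<Longrightarrow> e \<subseteq> {1..n} \<and> card e = 2 \<and> congested \<F> s e"
    and "e1 \<inter> e2 = {}" "e1 \<inter> e3 = {}" "e2 \<inter> e3 = {}"
  shows False
proof -
  let ?h = "\<lambda>e. {A \<in> \<F>. A \<inter> e \<noteq> {}}"
  have e: "e \<subseteq> {1..n}" "card e \<le> 2" "real (card \<F>) / 2 - s < real (card (?h e))"
    if "e \<in> {e1, e2, e3}" for e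
    using assms(1)[OF that] by (auto simp: congested_def)
  have pair: "card (?h e) + card (?h e') \<le> card (?h e \<union> ?h e') + 8 * N"
    and both: "card (?h e \<inter> ?h e') \<le> 8 * N"
    if "e \<in> {e1, e2, e3}" "e' \<in> {e1, e2, e3}" "e \<inter> e' = {}" for e e'
  proof -
    note ee = e(1)[OF that(1)] e(1)[OF that(2)] e(2)[OF that(1)] e(2)[OF that(2)] that(3)
    have "?h e \<inter> ?h e' = {A \<in> \<F>. A \<inter> e \<noteq> {} \<and> A \<inter> e' \<noteq> {}}" by auto
    then show "card (?h e \<inter> ?h e') \<le> 8 * N" using card_meet_both[OF ee] by simp
    show "card (?h e) + card (?h e') \<le> card (?h e \<union> ?h e') + 8 * N" by (rule card_meet_add[OF ee])
  qed
  have "card (?h e1) + card (?h e2) + card (?h e3) \<le> card \<F> + 24 * N"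
  proof -
    have "card (?h e1 \<union> ?h e2) + card (?h e3) =
        card (?h e1 \<union> ?h e2 \<union> ?h e3) + card ((?h e1 \<union> ?h e2) \<inter> ?h e3)"
      using finite_F by (intro card_Un_Int) auto
    moreover have "card (?h e1 \<union> ?h e2 \<union> ?h e3) \<le> card \<F>"
      using finite_F by (intro card_mono) auto
    moreover have "card ((?h e1 \<union> ?h e2) \<inter> ?h e3) \<le> card (?h e1 \<inter> ?h e3) + card (?h e2 \<inter> ?h e3)"
      unfolding Int_Un_distrib2 by (rule card_Un_le)
    moreover have "card (?h e1) + card (?h e2) \<le> card (?h e1 \<union> ?h e2) + 8 * N"
      by (rule pair) (simp_all add: assms(2))
    moreover have "card (?h e1 \<inter> ?h e3) \<le> 8 * N" "card (?h e2 \<inter> ?h e3) \<le> 8 * N"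
      by (rule both; simp add: assms(3,4))+
    ultimately show ?thesis by linarith
  qed
  then have "real (card (?h e1)) + real (card (?h e2)) + real (card (?h e3)) \<le> real (card \<F>) + 24 * real N"
    by linarith
  moreover have "real (card \<F>) / 2 - s < real (card (?h e1))" "real (card \<F>) / 2 - s < real (card (?h e2))"
    "real (card \<F>) / 2 - s < real (card (?h e3))"
    by (rule e(3); simp)+
  moreover have "0 < real N" using N_pos by simp
  ultimately show False using s_ge F_large by argo
qed

text \<open>
  A path that reaches height 2 either starts with two up steps, which the codegree bounds, or has a
  down step among its first two steps and must make up for it.
\<close>

lemma card_reach_2_le:
  assumes "R \<subseteq> {1..n}"
  shows "card {A \<in> \<F>. A \<subseteq> R \<and> reach 2 R A} \<le>
    2 * N + ((card R - 1) choose (k - 3)) + ((card R - 2) choose (k - 3))"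
proof (cases "R = {}")
  case True
  then show ?thesis by (simp add: reach_def)
next
  case False
  define d where "d = k - 3"
  have k: "k = d + 3" using k3 by (simp add: d_def)
  have finR: "finite R" using assms finite_subset by blast
  define r where "r = Min R"
  have r: "r \<in> R" using False finR by (simp add: r_def)
  have sub: "{A \<in> \<F>. A \<subseteq> R \<and> P A} \<subseteq> nsets R k" for P using F_elem by (auto simp: nsets_def)
  have without: "card {A \<in> \<F>. A \<subseteq> R \<and> r \<notin> A \<and> reach 2 R A} \<le> card (R - ({} \<union> {r})) choose d"
    by (rule card_family_reach_le[where s = 2 and R = "R - {r}"])
      (use sub reach_Min_notin[OF finR, of 2] in \<open>auto simp: finR k r_def eval_nat_numeral\<close>)
  have "with": "card {A \<in> \<F>. A \<subseteq> R \<and> r \<in> A \<and> reach 2 R A} \<le> 2 * N + ((card R - 2) choose d)"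
  proof (cases "R - {r} = {}")
    case True
    have "\<not> reach 2 R A" for A
      using reach_Min_in[OF finR, of 0 A] True by (auto simp: r_def reach_def eval_nat_numeral)
    then show ?thesis by simp
  next
    case False
    define q where "q = Min (R - {r})"
    have q: "q \<in> R" "q \<noteq> r" using Min_in[of "R - {r}"] False finR by (auto simp: q_def)
    have "card {A \<in> \<F>. A \<subseteq> R \<and> r \<in> A \<and> reach 2 R A} \<le>
       card {A \<in> \<F>. r \<in> A \<and> q \<in> A} + card {A \<in> \<F>. A \<subseteq> R \<and> r \<in> A \<and> q \<notin> A \<and> reach 2 R A}"
      by (rule card_filter_disj_le[OF finite_F]) auto
    moreover have "card {A \<in> \<F>. A \<subseteq> R \<and> r \<in> A \<and> q \<notin> A \<and> reach 2 R A} \<le> card (R - ({r} \<union> {q})) choose d"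
    proof (rule card_family_reach_le[where s = 1 and R = "R - {r} - {q}"])
      fix A assume A: "A \<in> {A \<in> \<F>. A \<subseteq> R \<and> r \<in> A \<and> q \<notin> A \<and> reach 2 R A}"
      then have "reach (Suc 0) (R - {r}) A"
        using reach_Min_in[OF finR, of 0 A] by (simp add: r_def eval_nat_numeral)
      then show "{r} \<subseteq> A \<and> A \<inter> {q} = {} \<and> reach (Suc 1) (R - {r} - {q}) A"
        using A reach_Min_notin[of "R - {r}" "Suc 0" A] finR by (simp add: q_def)
    qed (use sub in \<open>auto simp: finR k r eval_nat_numeral\<close>)
    moreover have "card (R - ({r} \<union> {q})) = card R - 2"
      using q r finR by simp
    moreover have "card {A \<in> \<F>. r \<in> A \<and> q \<in> A} \<le> 2 * N"
      by (rule codegree) (use q r assms in auto)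
    ultimately show ?thesis by simp
  qed
  have "card {A \<in> \<F>. A \<subseteq> R \<and> reach 2 R A} \<le>
     card {A \<in> \<F>. A \<subseteq> R \<and> r \<in> A \<and> reach 2 R A} + card {A \<in> \<F>. A \<subseteq> R \<and> r \<notin> A \<and> reach 2 R A}"
    by (rule card_filter_disj_le[OF finite_F]) auto
  then show ?thesis using without "with" r finR by (simp add: d_def)
qed

text \<open>
  Fix \<open>c \<in> C\<close>. The members inside \<open>{1..n} - Q\<close> number at most \<open>4 N\<close>, and for each of the at most
  seven other points \<open>b\<close> of \<open>Q\<close> fewer than \<open>2 N\<close> members contain \<open>b\<close> and avoid \<open>c\<close>.
\<close>

lemma card_avoid_le:
  assumes "Q \<subseteq> {1..n}" and "2 \<le> card Q" and "card Q \<le> 8" and "C \<subseteq> Q" and "C \<noteq> {}"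
    and reach: "\<And>A. A \<in> \<F> \<Longrightarrow> A \<inter> C = {} \<Longrightarrow> reach 2 ({1..n} - Q) A"
  shows "card {A \<in> \<F>. A \<inter> C = {}} \<le> 18 * N"
proof -
  define R where "R = {1..n} - Q"
  obtain c where c: "c \<in> C" using assms by blast
  have finQ: "finite Q" using assms finite_subset by blast
  have R: "card R = n - card Q" using assms finQ by (simp add: R_def card_Diff_subset)
  define d where "d = k - 3"
  have k: "k = d + 3" using k3 by (simp add: d_def)
  let ?X = "\<lambda>b. {A \<in> \<F>. b \<in> A \<and> c \<notin> A \<and> reach 2 R A}"
  have "{A \<in> \<F>. A \<inter> C = {}} \<subseteq> {A \<in> \<F>. A \<subseteq> R \<and> reach 2 R A} \<union> (\<Union>b\<in>Q - {c}. ?X b)"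
    using reach F_elem c by (fastforce simp: R_def)
  then have "card {A \<in> \<F>. A \<inter> C = {}} \<le> card ({A \<in> \<F>. A \<subseteq> R \<and> reach 2 R A} \<union> (\<Union>b\<in>Q - {c}. ?X b))"
    using finite_F finQ by (intro card_mono) auto
  also have "\<dots> \<le> card {A \<in> \<F>. A \<subseteq> R \<and> reach 2 R A} + card (\<Union>b\<in>Q - {c}. ?X b)"
    by (rule card_Un_le)
  also have "card (\<Union>b\<in>Q - {c}. ?X b) \<le> (\<Sum>b\<in>Q - {c}. card (?X b))"
    by (rule card_UN_le) (use finQ in simp)
  also have "\<dots> \<le> (\<Sum>b\<in>Q - {c}. 2 * N)"
  proof (rule sum_mono)
    fix b assume b: "b \<in> Q - {c}"
    have "card (?X b) \<le> card ({1..n} - ({b} \<union> {c})) choose d"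
      by (rule card_family_reach_le[where s = 1 and R = R])
        (use F_sub b c assms in \<open>auto simp: k R_def eval_nat_numeral\<close>)
    moreover have "card ({1..n} - ({b} \<union> {c})) = n - 2"
      using b c assms by (subst card_Diff_subset) auto
    ultimately show "card (?X b) \<le> 2 * N" using choose_n2 by (simp add: d_def)
  qed
  also have "\<dots> \<le> 7 * (2 * N)"
  proof -
    have "card (Q - {c}) \<le> 7" using assms(3,4) c by (subst card_Diff_singleton) auto
    then show ?thesis by simp
  qed
  also have "card {A \<in> \<F>. A \<subseteq> R \<and> reach 2 R A} \<le> 2 * N + ((card R - 1) choose (k - 3)) + ((card R - 2) choose (k - 3))"
    by (rule card_reach_2_le) (simp add: R_def)
  also have "\<dots> \<le> 2 * N + N + N"
    by (intro add_mono choose_le_N) (use R assms in auto)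
  finally show ?thesis by simp
qed

text \<open>
  Members that contain the first point \<open>r\<close> outside \<open>Q\<close> are bounded by the codegree of \<open>a\<close> and \<open>r\<close>;
  the others begin with a down step and have to reach height 2 afterwards.
\<close>

lemma card_trace_singleton_le:
  assumes "Q \<subseteq> {1..n}" and "2 \<le> card Q" and "a \<in> Q"
    and reach: "\<And>A. A \<in> \<F> \<Longrightarrow> A \<inter> Q = {a} \<Longrightarrow> reach 1 ({1..n} - Q) A"
  shows "card {A \<in> \<F>. A \<inter> Q = {a}} \<le> 3 * N"
proof (cases "{1..n} - Q = {}")
  case True
  then have empty: "{A \<in> \<F>. A \<inter> Q = {a}} = {}" using reach by (auto simp: reach_def)
  show ?thesis unfolding empty by simp
next
  case False
  define R where "R = {1..n} - Q"
  have finQ: "finite Q" using assms finite_subset by blast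
  have finR: "finite R" by (simp add: R_def)
  have cR: "card R = n - card Q" using assms finQ by (simp add: R_def card_Diff_subset)
  define d where "d = k - 3"
  have k: "k = d + 3" using k3 by (simp add: d_def)
  define r where "r = Min R"
  have r: "r \<in> R" unfolding r_def using Min_in[OF finR] False by (simp add: R_def)
  have "card {A \<in> \<F>. A \<inter> Q = {a}} \<le>
     card {A \<in> \<F>. a \<in> A \<and> r \<in> A} + card {A \<in> \<F>. A \<inter> Q = {a} \<and> r \<notin> A}"
    by (rule card_filter_disj_le[OF finite_F]) auto
  moreover have "card {A \<in> \<F>. a \<in> A \<and> r \<in> A} \<le> 2 * N"
    by (rule codegree) (use assms r in \<open>auto simp: R_def\<close>)
  moreover have "card {A \<in> \<F>. A \<inter> Q = {a} \<and> r \<notin> A} \<le> card ({1..n} - ({a} \<union> (Q - {a} \<union> {r}))) choose d"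
  proof (rule card_family_reach_le[where s = 1 and R = "R - {r}"])
    fix A assume A: "A \<in> {A \<in> \<F>. A \<inter> Q = {a} \<and> r \<notin> A}"
    then have "reach (Suc 1) (R - {r}) A"
      using reach_Min_notin[OF finR, of 1 A] reach[of A] by (simp add: r_def R_def)
    then show "{a} \<subseteq> A \<and> A \<inter> (Q - {a} \<union> {r}) = {} \<and> reach (Suc 1) (R - {r}) A"
      using A by auto
  qed (use F_sub assms in \<open>auto simp: k R_def eval_nat_numeral\<close>)
  moreover have "{1..n} - ({a} \<union> (Q - {a} \<union> {r})) = R - {r}" using assms by (auto simp: R_def)
  moreover have "card (R - {r}) choose d \<le> N"
    unfolding d_def by (rule choose_le_N) (use r finR cR assms in simp)
  ultimately show ?thesis by simp
qed

lemma card_trace_pair_le: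
  assumes "Q \<subseteq> {1..n}" and "3 \<le> card Q" and "p \<subseteq> Q" and "card p = 2"
    and reach: "\<And>A. A \<in> \<F> \<Longrightarrow> A \<inter> Q = p \<Longrightarrow> reach 1 ({1..n} - Q) A"
  shows "card {A \<in> \<F>. A \<inter> Q = p} \<le> N"
proof -
  define d where "d = k - 3"
  have k: "k = 3 + d" using k3 by (simp add: d_def)
  have finQ: "finite Q" using assms finite_subset by blast
  have "card {A \<in> \<F>. A \<inter> Q = p} \<le> card ({1..n} - (p \<union> (Q - p))) choose d"
    by (rule card_family_reach_le[where s = 0 and R = "{1..n} - Q"])
      (use F_sub assms in \<open>auto simp: k\<close>)
  also have "p \<union> (Q - p) = Q" using assms by auto
  also have "card ({1..n} - Q) choose d \<le> N"
    unfolding d_def by (rule choose_le_N) (use assms finQ in \<open>simp add: card_Diff_subset\<close>)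
  finally show ?thesis .
qed

text \<open>
  Every member counted on the left contributes at least 2 on the right: a member with exactly two
  points in \<open>Q\<close> is counted by both summands of one pair, and one with at least three points in
  \<open>Q\<close> contains at least two pairs that meet \<open>e\<close>. Weighting exact pairs in this way is what makes
  eight points in \<open>Q\<close> affordable.
\<close>

lemma card_multitrace_le:
  assumes "finite Q" and "e \<subseteq> Q"
  defines "P \<equiv> {p \<in> nsets Q 2. p \<inter> e \<noteq> {}}"
  shows "2 * card {A \<in> \<F>. A \<inter> e \<noteq> {} \<and> 2 \<le> card (A \<inter> Q)} \<le>
    (\<Sum>p\<in>P. card {A \<in> \<F>. p \<subseteq> A} + card {A \<in> \<F>. A \<inter> Q = p})"
proof -
  define \<H> where "\<H> = {A \<in> \<F>. A \<inter> e \<noteq> {} \<and> 2 \<le> card (A \<inter> Q)}"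
  have finP: "finite P" using assms by (simp add: finite_imp_finite_nsets)
  have fO: "finite \<H>" "\<H> \<subseteq> \<F>" using finite_F by (auto simp: \<H>_def)
  have swap: "(\<Sum>p\<in>P. card {A \<in> \<H>. W p A}) = (\<Sum>A\<in>\<H>. card {p \<in> P. W p A})" for W
    by (rule sum_multicount_gen) (use finP fO in auto)
  have two: "2 \<le> card {p \<in> P. p \<subseteq> A} + card {p \<in> P. A \<inter> Q = p}" if A: "A \<in> \<H>" for A
  proof -
    obtain x where x: "x \<in> A" "x \<in> e" "x \<in> Q" using A assms(2) by (auto simp: \<H>_def)
    show ?thesis
    proof (cases "card (A \<inter> Q) = 2")
      case True
      then have "A \<inter> Q \<in> P" using x assms(1) by (auto simp: P_def nsets_def)
      then have "{p \<in> P. A \<inter> Q = p} = {A \<inter> Q}" "A \<inter> Q \<in> {p \<in> P. p \<subseteq> A}" by auto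
      moreover from this have "0 < card {p \<in> P. p \<subseteq> A}" using finP by (auto simp: card_gt_0_iff)
      ultimately show ?thesis by simp
    next
      case False
      then have "3 \<le> card (A \<inter> Q)" using A by (auto simp: \<H>_def)
      then have "2 \<le> card (A \<inter> Q - {x})" using x assms(1) by (simp add: card_Diff_singleton)
      then obtain T where "T \<subseteq> A \<inter> Q - {x}" "card T = 2" by (meson obtain_subset_with_card_n)
      then obtain y z where yz: "y \<noteq> z" "{y, z} \<subseteq> A \<inter> Q - {x}" by (metis card_2_iff)
      then have sub: "{{x, y}, {x, z}} \<subseteq> {p \<in> P. p \<subseteq> A}" using x by (auto simp: P_def nsets_def)
      moreover have "card {{x, y}, {x, z}} = 2" using yz by (auto simp: doubleton_eq_iff)
      ultimately have "2 \<le> card {p \<in> P. p \<subseteq> A}" using card_mono[OF _ sub] finP by simp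
      then show ?thesis by simp
    qed
  qed
  have "2 * card \<H> = (\<Sum>A\<in>\<H>. 2)" by simp
  also have "\<dots> \<le> (\<Sum>A\<in>\<H>. card {p \<in> P. p \<subseteq> A} + card {p \<in> P. A \<inter> Q = p})"
    by (rule sum_mono) (use two in auto)
  also have "\<dots> = (\<Sum>p\<in>P. card {A \<in> \<H>. p \<subseteq> A} + card {A \<in> \<H>. A \<inter> Q = p})"
    by (simp add: sum.distrib swap)
  also have "\<dots> \<le> (\<Sum>p\<in>P. card {A \<in> \<F>. p \<subseteq> A} + card {A \<in> \<F>. A \<inter> Q = p})"
    using finite_F fO(2) by (intro sum_mono add_mono card_mono) auto
  finally show ?thesis by (simp add: \<H>_def)
qed

end

section \<open>Pairs of families that are shifted as far as possible\<close>

locale extremal_pair = bounded_pair +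
  assumes shifted: "\<And>i j. i \<in> {1..n} \<Longrightarrow> j \<in> {1..n} \<Longrightarrow> i < j \<Longrightarrow>
    \<not> congested \<F> s {i, j} \<Longrightarrow> \<not> congested \<G> t {i, j} \<Longrightarrow> stable {i, j} \<F> \<and> stable {i, j} \<G>"
begin

lemma extremal_pair_swap: "extremal_pair n k \<G> \<F> t s"
  using bounded_pair_swap shifted by (simp add: extremal_pair_def extremal_pair_axioms_def)

text \<open>
  Since every congested pair meets \<open>Q\<close>, both families are stable outside \<open>Q\<close>; the last hypothesis
  confines \<open>A \<inter> B\<close> to that part.
\<close>

lemma cross_reach:
  assumes cover: "\<And>e. e \<in> nsets {1..n} 2 \<Longrightarrow> congested \<F> s e \<or> congested \<G> t e \<Longrightarrow> e \<inter> Q \<noteq> {}"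
    and "A \<in> \<F>" and "\<not> reach 1 ({1..n} - Q) A" and "B \<in> \<G>" and "B \<inter> (A \<inter> Q) = {}"
  shows "reach 2 ({1..n} - Q) B"
proof (rule stable_cross_reach[of _ \<G> A B 1])
  show "stable ({1..n} - Q) \<G>"
  proof (rule stable_pairs)
    fix i j assume ij: "i \<in> {1..n} - Q" "j \<in> {1..n} - Q" "i < j"
    then have "{i, j} \<in> nsets {1..n} 2" "{i, j} \<inter> Q = {}" by (auto simp: nsets_def)
    then show "stable {i, j} \<G>" using cover[of "{i, j}"] shifted[of i j] ij by blast
  qed
  show "A \<inter> B \<subseteq> {1..n} - Q" using F_elem[OF assms(2)] assms(5) by blast
  show "finite A" using F_elem[OF assms(2)] by blast
qed (use assms cross in \<open>auto simp: cross_intersecting_def\<close>)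

text \<open>
  Without congested pairs \<open>\<G>\<close> is stable on all of \<open>{1..n}\<close> and too large for all of its members to
  reach height 2. Hence all members of \<open>\<F>\<close> reach height 1, and those avoiding the point 1 reach
  height 2 in the rest, so they are few and the degree of 1 is too large.
\<close>

lemma congested_edge:
  "\<exists>e\<in>nsets {1..n} 2. congested \<F> s e \<or> congested \<G> t e"
proof (rule ccontr)
  assume "\<not> ?thesis"
  then have none: "e \<inter> {} \<noteq> {}" if "e \<in> nsets {1..n} 2" "congested \<F> s e \<or> congested \<G> t e" for e
    using that by blast
  interpret swap: extremal_pair n k \<G> \<F> t s by (rule extremal_pair_swap)
  have N: "0 < real N" using N_pos by simp
  have reach_1: "reach 1 {1..n} A" if A: "A \<in> \<F>" for A
  proof (rule ccontr)
    assume "\<not> reach 1 {1..n} A"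
    then have "reach 2 {1..n} B" if "B \<in> \<G>" for B
      using cross_reach[of "{}" A B] none A that by auto
    then have "\<G> \<subseteq> {B \<in> \<G>. B \<subseteq> {1..n} \<and> reach 2 {1..n} B}"
      using swap.F_elem by blast
    then have "card \<G> \<le> card {B \<in> \<G>. B \<subseteq> {1..n} \<and> reach 2 {1..n} B}"
      using finite_G by (intro card_mono) auto
    also have "\<dots> \<le> 2 * N + ((card {1..n} - 1) choose (k - 3)) + ((card {1..n} - 2) choose (k - 3))"
      by (rule swap.card_reach_2_le) simp
    also have "\<dots> \<le> 8 * N" using choose_n1 choose_n2 by simp
    finally show False using G_large t_ge N by linarith
  qed
  have n: "1 \<in> {1..n}" "Min {1..n} = 1" using k3 kn by (auto intro: Min_eqI)
  let ?R = "{1..n} - {1}"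
  have "{A \<in> \<F>. 1 \<notin> A} \<subseteq> {A \<in> \<F>. A \<subseteq> ?R \<and> reach 2 ?R A}"
  proof
    fix A assume A: "A \<in> {A \<in> \<F>. 1 \<notin> A}"
    then have "reach (Suc 1) ?R A" using reach_Min_notin[of "{1..n}" 1 A] reach_1 n(2) by simp
    then show "A \<in> {A \<in> \<F>. A \<subseteq> ?R \<and> reach 2 ?R A}"
      using A F_elem[of A] by (auto simp: eval_nat_numeral)
  qed
  then have "card {A \<in> \<F>. 1 \<notin> A} \<le> card {A \<in> \<F>. A \<subseteq> ?R \<and> reach 2 ?R A}"
    using finite_F by (intro card_mono) auto
  also have "\<dots> \<le> 2 * N + ((card ?R - 1) choose (k - 3)) + ((card ?R - 2) choose (k - 3))"
    by (rule card_reach_2_le) simp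
  also have "\<dots> \<le> 2 * N + 2 * N + N"
  proof (intro add_mono choose_le_N order_refl)
    have "card ?R = n - 1" using n(1) by simp
    then show "(card ?R - 1) choose (k - 3) \<le> 2 * N" and "card ?R - 2 \<le> n - 3"
      using choose_n2 by (simp_all add: numeral_2_eq_2)
  qed
  finally have "card {A \<in> \<F>. 1 \<notin> A} \<le> 5 * N" by simp
  then show False
    using card_split[of "\<lambda>A. 1 \<in> A"] F_degree[OF n(1)] F_large s_ge N by linarith
qed

end

section \<open>A maximal matching of congested pairs\<close>

text \<open>
  The set \<open>M\<close> is a maximal matching of congested pairs: by maximality every congested pair meets the
  set \<open>Q\<close> of its endpoints.
\<close>

locale congested_matching = extremal_pair +
  fixes M :: "nat set set"
  assumes M_sub: "M \<subseteq> nsets {1..n} 2" and M_disjoint: "disjoint M"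
    and M_congested: "\<And>e. e \<in> M \<Longrightarrow> congested \<F> s e \<or> congested \<G> t e"
    and M_cover: "\<And>e. e \<in> nsets {1..n} 2 \<Longrightarrow> congested \<F> s e \<or> congested \<G> t e \<Longrightarrow> e \<inter> \<Union>M \<noteq> {}"
begin

abbreviation Q :: "nat set" where "Q \<equiv> \<Union>M"

lemma congested_matching_swap: "congested_matching n k \<G> \<F> t s M"
  using extremal_pair_swap M_sub M_disjoint M_congested M_cover
  by (simp add: congested_matching_def congested_matching_axioms_def disj_commute)

lemma Q_sub: "Q \<subseteq> {1..n}"
  using M_sub by (auto simp: nsets_def)

lemma finite_Q: "finite Q"
  by (rule finite_subset[OF Q_sub]) simp

lemma finite_M: "finite M"
  using M_sub by (meson finite_atLeastAtMost finite_imp_finite_nsets finite_subset)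

lemma edge:
  assumes "e \<in> M"
  shows "finite e" "card e = 2" "e \<subseteq> {1..n}" "e \<subseteq> Q"
  using M_sub assms by (auto simp: nsets_def)

lemma edges_disjoint: "e \<in> M \<Longrightarrow> e' \<in> M \<Longrightarrow> e \<noteq> e' \<Longrightarrow> e \<inter> e' = {}"
  using M_disjoint by (auto simp: disjoint_def)

lemma card_congested_le: "card {e \<in> M. congested \<F> s e} \<le> 2"
proof (rule ccontr)
  assume "\<not> ?thesis"
  then obtain T where "T \<subseteq> {e \<in> M. congested \<F> s e}" "card T = 3"
    using obtain_subset_with_card_n[of 3 "{e \<in> M. congested \<F> s e}"] by auto
  then obtain e1 e2 e3 where e: "e1 \<in> M" "e2 \<in> M" "e3 \<in> M" "e1 \<noteq> e2" "e1 \<noteq> e3" "e2 \<noteq> e3"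
    and c: "congested \<F> s e1" "congested \<F> s e2" "congested \<F> s e3"
    by (auto simp: card_3_iff)
  have "e1 \<inter> e2 = {}" "e1 \<inter> e3 = {}" "e2 \<inter> e3 = {}" using e by (simp_all add: edges_disjoint)
  then show False
  proof (rule no_three_congested[rotated])
    fix e assume "e \<in> {e1, e2, e3}"
    then have "e \<in> M" "congested \<F> s e" using e c by auto
    then show "e \<subseteq> {1..n} \<and> card e = 2 \<and> congested \<F> s e" using edge(2,3) by simp
  qed
qed

lemma card_not_congested_le: "card {e \<in> M. \<not> congested \<F> s e} \<le> 2"
proof -
  have "card {e \<in> M. \<not> congested \<F> s e} \<le> card {e \<in> M. congested \<G> t e}"
    using M_congested finite_M by (intro card_mono) auto
  also have "\<dots> \<le> 2" by (rule congested_matching.card_congested_le[OF congested_matching_swap])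
  finally show ?thesis .
qed

lemma card_M: "card M = card {e \<in> M. congested \<F> s e} + card {e \<in> M. \<not> congested \<F> s e}"
proof -
  have "M = {e \<in> M. congested \<F> s e} \<union> {e \<in> M. \<not> congested \<F> s e}" by auto
  moreover have "card ({e \<in> M. congested \<F> s e} \<union> {e \<in> M. \<not> congested \<F> s e}) =
      card {e \<in> M. congested \<F> s e} + card {e \<in> M. \<not> congested \<F> s e}"
    by (rule card_Un_disjoint) (use finite_M in auto)
  ultimately show ?thesis by simp
qed

lemma card_Q: "card Q = 2 * card M"
proof -
  have "card Q = sum card M"
    using M_disjoint edge(1) by (intro card_Union_disjoint) (auto simp: disjoint_def pairwise_def disjnt_def)
  also have "\<dots> = (\<Sum>e\<in>M. 2)" by (rule sum.cong) (use edge(2) in auto)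
  finally show ?thesis by simp
qed

lemma card_Q_bounds:
  assumes "e \<in> M"
  shows "2 \<le> card Q" and "card Q \<le> 8"
proof -
  have "card M > 0" using finite_M assms by (auto simp: card_gt_0_iff)
  then show "2 \<le> card Q" using card_Q by simp
  show "card Q \<le> 8" using card_Q card_M card_congested_le card_not_congested_le by simp
qed

text \<open>
  A member of \<open>\<F>\<close> that stays low outside \<open>Q\<close> forces every member of \<open>\<G>\<close> avoiding its trace on
  \<open>Q\<close> to climb, which leaves few of them. For traces of size 1 this contradicts the degree bound of
  \<open>\<G>\<close>, and for traces of size 2 it contradicts the presence of a disjoint congested pair of \<open>\<G>\<close>;
  hence the bounds \<open>card_singleton_trace_le\<close> and \<open>card_pair_trace_le\<close>.
\<close>

lemma card_avoid_trace_le: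
  assumes "A \<in> \<F>" and "\<not> reach 1 ({1..n} - Q) A" and "A \<inter> Q \<noteq> {}"
  shows "card {B \<in> \<G>. B \<inter> (A \<inter> Q) = {}} \<le> 18 * N"
proof (rule bounded_pair.card_avoid_le[OF bounded_pair_swap Q_sub])
  obtain e where "e \<in> M" using assms(3) by blast
  then show "2 \<le> card Q" "card Q \<le> 8" by (rule card_Q_bounds)+
  fix B assume "B \<in> \<G>" "B \<inter> (A \<inter> Q) = {}"
  then show "reach 2 ({1..n} - Q) B" using cross_reach[OF M_cover assms(1,2)] by blast
qed (use assms(3) in auto)

lemma card_singleton_trace_le:
  assumes "a \<in> Q"
  shows "card {A \<in> \<F>. A \<inter> Q = {a}} \<le> 3 * N"
proof (rule card_trace_singleton_le[OF Q_sub _ assms])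
  obtain e where "e \<in> M" using assms by blast
  then show "2 \<le> card Q" by (rule card_Q_bounds)
  fix A assume A: "A \<in> \<F>" "A \<inter> Q = {a}"
  show "reach 1 ({1..n} - Q) A"
  proof (rule ccontr)
    assume "\<not> reach 1 ({1..n} - Q) A"
    then have "card {B \<in> \<G>. a \<notin> B} \<le> 18 * N" using card_avoid_trace_le[of A] A by simp
    moreover have "card {B \<in> \<G>. a \<in> B} + card {B \<in> \<G>. a \<notin> B} = card \<G>"
      by (rule bounded_pair.card_split[OF bounded_pair_swap])
    moreover have "real (card {B \<in> \<G>. a \<in> B}) \<le> real (card \<G>) / 2 - t"
      using G_degree Q_sub assms by blast
    moreover have "0 < real N" using N_pos by simp
    ultimately show False using G_large t_ge by linarith
  qed
qed

lemma card_pair_trace_le: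
  assumes "p \<subseteq> Q" and "card p = 2" and g: "g \<in> M" "congested \<G> t g" "p \<inter> g = {}"
  shows "card {A \<in> \<F>. A \<inter> Q = p} \<le> N"
proof (rule card_trace_pair_le[OF Q_sub _ assms(1,2)])
  have "card (p \<union> g) = 4"
    using assms(2) edge[OF g(1)] g(3) finite_subset[OF assms(1) finite_Q] by (subst card_Un_disjoint) auto
  moreover have "card (p \<union> g) \<le> card Q"
    using assms(1) edge(4)[OF g(1)] finite_Q by (intro card_mono) auto
  ultimately show "3 \<le> card Q" by simp
  fix A assume A: "A \<in> \<F>" "A \<inter> Q = p"
  show "reach 1 ({1..n} - Q) A"
  proof (rule ccontr)
    assume "\<not> reach 1 ({1..n} - Q) A"
    moreover have "A \<inter> Q \<noteq> {}" using assms(2) A by auto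
    \<comment> \<open>All but \<open>18 N\<close> members of \<open>\<G>\<close> meet \<open>p\<close> and at least \<open>28 N\<close> meet \<open>g\<close>, but only \<open>8 N\<close> meet both.\<close>
    ultimately have few: "card {B \<in> \<G>. B \<inter> p = {}} \<le> 18 * N" using card_avoid_trace_le[of A] A by simp
    have "card ({B \<in> \<G>. B \<inter> p \<noteq> {}} \<union> {B \<in> \<G>. B \<inter> g \<noteq> {}}) \<le> card \<G>"
      using finite_G by (intro card_mono) auto
    moreover have "card {B \<in> \<G>. B \<inter> p \<noteq> {}} + card {B \<in> \<G>. B \<inter> g \<noteq> {}} \<le>
        card ({B \<in> \<G>. B \<inter> p \<noteq> {}} \<union> {B \<in> \<G>. B \<inter> g \<noteq> {}}) + 8 * N"
    proof (rule bounded_pair.card_meet_add[OF bounded_pair_swap])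
      show "p \<subseteq> {1..n}" using assms(1) Q_sub by (rule subset_trans)
    qed (use assms(2) edge[OF g(1)] g(3) in simp_all)
    moreover have "card {B \<in> \<G>. B \<inter> p = {}} + card {B \<in> \<G>. B \<inter> p \<noteq> {}} = card \<G>"
      by (rule bounded_pair.card_split[OF bounded_pair_swap])
    moreover have "real (card \<G>) / 2 - t < real (card {B \<in> \<G>. B \<inter> g \<noteq> {}})"
      using g(2) by (simp add: congested_def)
    ultimately show False using few G_large t_ge by linarith
  qed
qed

text \<open>
  A matching with four edges has two edges that are congested for \<open>\<G>\<close> but not for \<open>\<F>\<close>. They are
  disjoint from \<open>e\<close>, so only the endpoint of \<open>p\<close> outside \<open>e\<close> can lie on them, and it cannot lie on
  both.
\<close>

lemma disjoint_congested_edge: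
  assumes "card M = 4" and e: "e \<in> M" "congested \<F> s e" and p: "card p = 2" "p \<inter> e \<noteq> {}"
  obtains g where "g \<in> M" and "congested \<G> t g" and "p \<inter> g = {}"
proof -
  obtain x where x: "x \<in> p" "x \<in> e" using p(2) by blast
  have "card (p - {x}) = 1" using p(1) x by simp
  then obtain y where "p - {x} = {y}" by (meson card_1_singletonE)
  then have y: "p = {x, y}" using x by blast
  have "2 \<le> card {e \<in> M. \<not> congested \<F> s e}" using assms(1) card_M card_congested_le by linarith
  then obtain T where "T \<subseteq> {e \<in> M. \<not> congested \<F> s e}" "card T = 2" by (meson obtain_subset_with_card_n)
  then obtain g h where gh: "g \<in> M" "\<not> congested \<F> s g" "h \<in> M" "\<not> congested \<F> s h" "g \<noteq> h"
    by (auto simp: card_2_iff)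
  have "g \<noteq> e" "h \<noteq> e" using gh e by auto
  then have "x \<notin> g" "x \<notin> h" using edges_disjoint[of g e] edges_disjoint[of h e] gh e x by auto
  moreover have "y \<notin> g \<or> y \<notin> h" using edges_disjoint[of g h] gh by auto
  ultimately have "p \<inter> g = {} \<or> p \<inter> h = {}" using y by auto
  then show ?thesis using that gh M_congested by blast
qed

text \<open>
  Congestion of \<open>e\<close> requires more than \<open>28 N\<close> members meeting \<open>e\<close>. At most \<open>6 N\<close> of these meet \<open>Q\<close>
  in a single point. The others are bounded by counting pairs in \<open>Q\<close> that meet \<open>e\<close>. With at most six
  points in \<open>Q\<close> there are at most 9 such pairs, and bounding every codegree by \<open>2 N\<close> suffices. With
  eight points there are 13 pairs, and the better bound \<open>N\<close> for members meeting \<open>Q\<close> in exactly such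
  a pair is needed.
\<close>

lemma not_congested:
  assumes e: "e \<in> M"
  shows "\<not> congested \<F> s e"
proof
  assume heavy: "congested \<F> s e"
  obtain a b where ab: "e = {a, b}" using edge(2)[OF e] by (auto simp: card_2_iff)
  have abQ: "a \<in> Q" "b \<in> Q" using edge(4)[OF e] ab by auto
  define P where "P = {p \<in> nsets Q 2. p \<inter> e \<noteq> {}}"
  have finP: "finite P" using finite_Q by (simp add: P_def finite_imp_finite_nsets)
  have P: "p \<subseteq> Q" "card p = 2" "p \<inter> e \<noteq> {}" if "p \<in> P" for p
    using that by (auto simp: P_def nsets_def)
  have pair: "card {A \<in> \<F>. p \<subseteq> A} \<le> 2 * N" if "p \<in> P" for p
  proof -
    obtain x y where xy: "p = {x, y}" "x \<noteq> y" using P(2)[OF \<open>p \<in> P\<close>] by (auto simp: card_2_iff)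
    have "p \<subseteq> {1..n}" using P(1)[OF \<open>p \<in> P\<close>] Q_sub by (rule subset_trans)
    then show ?thesis using codegree[of x y] xy by simp
  qed
  \<comment> \<open>Of the pairs in \<open>Q\<close>, those inside \<open>Q - e\<close> miss \<open>e\<close>, which leaves \<open>2 |Q| - 3\<close>.\<close>
  have cP: "card P + 3 = 2 * card Q"
  proof -
    have split: "nsets Q 2 = P \<union> nsets (Q - e) 2" "P \<inter> nsets (Q - e) 2 = {}"
      by (auto simp: P_def nsets_def)
    have "card (nsets Q 2) = card P + card (nsets (Q - e) 2)"
      unfolding split(1) using finP finite_Q split(2)
      by (intro card_Un_disjoint) (simp_all add: finite_imp_finite_nsets)
    moreover have "card (Q - e) = card Q - 2"
      using edge[OF e] by (simp add: card_Diff_subset)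
    ultimately have "card Q choose 2 = card P + ((card Q - 2) choose 2)" by (simp add: card_nsets)
    moreover have "card Q \<in> {2, 4, 6, 8}"
    proof -
      have "card M \<in> {1, 2, 3, 4}" using card_Q card_Q_bounds[OF e] by auto
      then show ?thesis using card_Q by auto
    qed
    ultimately show ?thesis by (auto simp: choose_two)
  qed
  have "card {A \<in> \<F>. A \<inter> e \<noteq> {}} \<le> 6 * N + card {A \<in> \<F>. A \<inter> e \<noteq> {} \<and> 2 \<le> card (A \<inter> Q)}"
  proof -
    let ?X = "{A \<in> \<F>. A \<inter> Q = {a}}" and ?Y = "{A \<in> \<F>. A \<inter> Q = {b}}"
      and ?Z = "{A \<in> \<F>. A \<inter> e \<noteq> {} \<and> 2 \<le> card (A \<inter> Q)}"
    have "A \<in> ?X \<union> (?Y \<union> ?Z)" if A: "A \<in> \<F>" "A \<inter> e \<noteq> {}" for A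
    proof (cases "2 \<le> card (A \<inter> Q)")
      case False
      obtain x where x: "x \<in> A" "x \<in> e" using A by blast
      then have xQ: "x \<in> A \<inter> Q" using edge(4)[OF e] by blast
      then have "card (A \<inter> Q) \<noteq> 0" using finite_Q by (metis card_eq_0_iff empty_iff finite_Int)
      then have "card (A \<inter> Q) = 1" using False by linarith
      then have "A \<inter> Q = {x}" using xQ by (metis card_1_singletonE singletonD)
      then show ?thesis using x ab A by auto
    qed (use A in auto)
    then have "{A \<in> \<F>. A \<inter> e \<noteq> {}} \<subseteq> ?X \<union> (?Y \<union> ?Z)" by blast
    then have "card {A \<in> \<F>. A \<inter> e \<noteq> {}} \<le> card (?X \<union> (?Y \<union> ?Z))"
      using finite_F by (intro card_mono) auto
    also have "\<dots> \<le> card ?X + (card ?Y + card ?Z)"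
      using card_Un_le[of ?X "?Y \<union> ?Z"] card_Un_le[of ?Y ?Z] by linarith
    finally show ?thesis
      using card_singleton_trace_le[OF abQ(1)] card_singleton_trace_le[OF abQ(2)] by linarith
  qed
  moreover have "2 * card {A \<in> \<F>. A \<inter> e \<noteq> {} \<and> 2 \<le> card (A \<inter> Q)} \<le>
      (\<Sum>p\<in>P. card {A \<in> \<F>. p \<subseteq> A} + card {A \<in> \<F>. A \<inter> Q = p})"
    unfolding P_def by (rule card_multitrace_le[OF finite_Q edge(4)[OF e]])
  moreover have "(\<Sum>p\<in>P. card {A \<in> \<F>. p \<subseteq> A} + card {A \<in> \<F>. A \<inter> Q = p}) \<le> 39 * N"
  proof (cases "card M = 4")
    case False
    then have "card P \<le> 9" using cP card_Q card_Q_bounds[OF e] by linarith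
    have "(\<Sum>p\<in>P. card {A \<in> \<F>. p \<subseteq> A} + card {A \<in> \<F>. A \<inter> Q = p}) \<le> (\<Sum>p\<in>P. 4 * N)"
    proof (rule sum_mono)
      fix p assume p: "p \<in> P"
      have "card {A \<in> \<F>. A \<inter> Q = p} \<le> card {A \<in> \<F>. p \<subseteq> A}"
        using finite_F by (intro card_mono) auto
      then show "card {A \<in> \<F>. p \<subseteq> A} + card {A \<in> \<F>. A \<inter> Q = p} \<le> 4 * N"
        using pair[OF p] by linarith
    qed
    also have "\<dots> = card P * (4 * N)" by simp
    also have "\<dots> \<le> 9 * (4 * N)" using \<open>card P \<le> 9\<close> by (rule mult_le_mono1)
    finally show ?thesis by simp
  next
    case True
    have exact: "card {A \<in> \<F>. A \<inter> Q = p} \<le> N" if p: "p \<in> P" for p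
    proof -
      obtain g where "g \<in> M" "congested \<G> t g" "p \<inter> g = {}"
        by (rule disjoint_congested_edge[OF True e heavy P(2,3)[OF p]])
      then show ?thesis by (rule card_pair_trace_le[OF P(1,2)[OF p]])
    qed
    have "(\<Sum>p\<in>P. card {A \<in> \<F>. p \<subseteq> A} + card {A \<in> \<F>. A \<inter> Q = p}) \<le> (\<Sum>p\<in>P. 2 * N + N)"
      by (intro sum_mono add_mono pair exact)
    also have "\<dots> = 13 * (3 * N)" using cP card_Q True by simp
    finally show ?thesis by simp
  qed
  ultimately have "2 * card {A \<in> \<F>. A \<inter> e \<noteq> {}} \<le> 51 * N" by linarith
  moreover have "real (card \<F>) / 2 - s < real (card {A \<in> \<F>. A \<inter> e \<noteq> {}})"
    using heavy by (simp add: congested_def)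
  moreover have "0 < real N" using N_pos by simp
  ultimately show False using F_large s_ge by linarith
qed

lemma M_empty: "M = {}"
  using M_congested not_congested congested_matching.not_congested[OF congested_matching_swap] by blast

end

lemma (in extremal_pair) inconsistent: False
proof -
  define E where "E = {e \<in> nsets {1..n} 2. congested \<F> s e \<or> congested \<G> t e}"
  have fin: "finite {M. M \<subseteq> E \<and> disjoint M}"
    by (rule finite_subset[of _ "Pow E"]) (auto simp: E_def finite_imp_finite_nsets)
  have ne: "{M. M \<subseteq> E \<and> disjoint M} \<noteq> {}" by (auto intro!: exI[of _ "{}"])
  obtain M where M: "M \<subseteq> E" "disjoint M"
    and max: "\<And>M'. M' \<subseteq> E \<Longrightarrow> disjoint M' \<Longrightarrow> M \<subseteq> M' \<Longrightarrow> M = M'"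
    using finite_has_maximal[OF fin ne] by auto
  have cover: "e \<inter> \<Union>M \<noteq> {}" if "e \<in> E" for e
  proof
    assume dis: "e \<inter> \<Union>M = {}"
    have "e \<noteq> {}" using that by (auto simp: E_def nsets_def)
    then have "e \<notin> M" using dis by blast
    moreover have "disjoint (insert e M)"
      using M(2) dis by (auto simp: disjoint_def)
    ultimately show False using max[of "insert e M"] that M(1) by blast
  qed
  interpret congested_matching n k \<F> \<G> s t M
    using M cover by unfold_locales (auto simp: E_def)
  obtain e where "e \<in> E" using congested_edge by (auto simp: E_def)
  then show False using cover M_empty by blast
qed

section \<open>Reduction to extremal pairs\<close>

lemma card_shift_degree_le:
  assumes "finite \<H>" and "v \<noteq> i"
  shows "card {A \<in> shift i j \<H>. v \<in> A} \<le> card {A \<in> \<H>. v \<in> A}"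
  unfolding card_shift_filter
  by (rule card_mono) (use assms in \<open>auto simp: shift_set_def split: if_splits\<close>)

lemma card_shift_degree_target_le:
  assumes "finite \<H>"
  shows "card {A \<in> shift i j \<H>. i \<in> A} \<le> card {A \<in> \<H>. A \<inter> {i, j} \<noteq> {}}"
  unfolding card_shift_filter
  by (rule card_mono) (use assms in \<open>auto simp: shift_set_def split: if_splits\<close>)

lemma shift_degree_bound:
  assumes "finite \<H>" and "\<not> congested \<H> s {i, j}" and "v \<in> V"
    and "\<And>v. v \<in> V \<Longrightarrow> real (card {A \<in> \<H>. v \<in> A}) \<le> real (card \<H>) / 2 - s"
  shows "real (card {A \<in> shift i j \<H>. v \<in> A}) \<le> real (card \<H>) / 2 - s"
proof (cases "v = i")
  case True
  then show ?thesis
    using card_shift_degree_target_le[OF assms(1), of i j] assms(2) by (auto simp: congested_def)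
next
  case False
  then show ?thesis
    using card_shift_degree_le[OF assms(1) False, of j] assms(4)[OF assms(3)] by linarith
qed

lemma (in bounded_pair) inconsistent: False
proof -
  define P where "P = (\<lambda>\<A> \<B>. \<A> \<subseteq> nsets {1..n} k \<and> \<B> \<subseteq> nsets {1..n} k \<and> cross_intersecting \<A> \<B>
    \<and> card \<A> = card \<F> \<and> card \<B> = card \<G>
    \<and> (\<forall>v\<in>{1..n}. real (card {A \<in> \<A>. v \<in> A}) \<le> real (card \<A>) / 2 - s)
    \<and> (\<forall>v\<in>{1..n}. real (card {B \<in> \<B>. v \<in> B}) \<le> real (card \<B>) / 2 - t))"
  have P0: "P \<F> \<G>" using F_sub G_sub cross F_degree G_degree by (simp add: P_def)
  obtain \<A> \<B> where P: "P \<A> \<B>"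
    and ext: "\<And>i j. i < j \<Longrightarrow> P (shift i j \<A>) (shift i j \<B>) \<Longrightarrow> stable {i, j} \<A> \<and> stable {i, j} \<B>"
    by (rule exists_extremal_pair[of P \<F> \<G> "{1..n}" k k]) (use P0 in \<open>auto simp: P_def\<close>)
  have fin: "finite \<A>" "finite \<B>"
    using P unfolding P_def by (meson finite_atLeastAtMost finite_imp_finite_nsets finite_subset)+
  have "P (shift i j \<A>) (shift i j \<B>)"
    if "i \<in> {1..n}" "\<not> congested \<A> s {i, j}" "\<not> congested \<B> t {i, j}" for i j
    using P shift_degree_bound[OF fin(1) that(2), of _ "{1..n}"] shift_degree_bound[OF fin(2) that(3), of _ "{1..n}"]
      shift_subset_nsets[OF _ that(1)] cross_intersecting_shift
    unfolding P_def card_shift by meson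
  then have st: "stable {i, j} \<A> \<and> stable {i, j} \<B>"
    if "i \<in> {1..n}" "i < j" "\<not> congested \<A> s {i, j}" "\<not> congested \<B> t {i, j}" for i j
    using that ext by blast
  have "bounded_pair n k \<A> \<B> s t"
    using P k3 kn s_ge t_ge F_large G_large unfolding P_def by unfold_locales auto
  then have "extremal_pair n k \<A> \<B> s t"
    using st by (simp add: extremal_pair_def extremal_pair_axioms_def)
  then show False by (rule extremal_pair.inconsistent)
qed

text \<open>
  The ratio of the two binomial coefficients is
  \<open>n (n - 1) (n - 2) / (k (k - 1) (k - 2))\<close>; for \<open>n < 2 k\<close> the three quotients are at most 2, 2 and 3.
\<close>

lemma twice_le_of_choose_ge:
  fixes n k :: nat
  assumes "3 \<le> k" and "k \<le> n" and "12 * ((n - 3) choose (k - 3)) < n choose k"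
  shows "2 * k \<le> n"
proof (rule ccontr)
  assume small: "\<not> ?thesis"
  define j m where "j = k - 3" and "m = n - 3"
  then have j: "k = Suc (Suc (Suc j))" and m: "n = Suc (Suc (Suc m))"
    using assms(1,2) by simp_all
  have key: "a3 \<le> 12 * a0"
    if "x3 * a3 = y3 * a2" "x2 * a2 = y2 * a1" "x1 * a1 = y1 * a0"
      and "y3 \<le> 2 * x3" "y2 \<le> 2 * x2" "y1 \<le> 3 * x1" and "0 < x1" "0 < x2" "0 < x3"
    for a0 a1 a2 a3 x1 x2 x3 y1 y2 y3 :: nat
  proof -
    have "x1 * (x2 * (x3 * a3)) = y3 * (x1 * (x2 * a2))" unfolding that(1) by (simp only: ac_simps)
    also have "\<dots> = y3 * (y2 * (x1 * a1))" unfolding that(2) by (simp only: ac_simps)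
    also have "\<dots> = y3 * (y2 * (y1 * a0))" unfolding that(3) ..
    also have "\<dots> \<le> (2 * x3) * ((2 * x2) * ((3 * x1) * a0))" by (intro mult_le_mono that order_refl)
    also have "\<dots> = x1 * (x2 * (x3 * (12 * a0)))" by simp
    finally show ?thesis using that(7-9) by simp
  qed
  have "n choose k \<le> 12 * (m choose j)"
    unfolding j m
    by (rule key[OF Suc_times_binomial Suc_times_binomial Suc_times_binomial]) (use small j m in auto)
  then show False using assms(3) by (simp add: j m)
qed

lemma degree_le_rho:
  assumes "finite \<H>" and "\<H> \<noteq> {}" and "v \<in> {1..n}"
  shows "real (card {A \<in> \<H>. v \<in> A}) \<le> rho n \<H> * real (card \<H>)"
proof -
  have "card (link \<H> v) = card {A \<in> \<H>. v \<in> A}"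
  proof -
    have "link \<H> v = (\<lambda>A. A - {v}) ` {A \<in> \<H>. v \<in> A}" by (auto simp: link_def)
    moreover have "inj_on (\<lambda>A. A - {v}) {A \<in> \<H>. v \<in> A}" by (auto simp: inj_on_def)
    ultimately show ?thesis by (simp add: card_image)
  qed
  moreover have "real (card (link \<H> v)) / real (card \<H>) \<le> rho n \<H>"
    unfolding rho_def by (rule Max_ge) (use assms in auto)
  moreover have "0 < real (card \<H>)" using assms by (simp add: card_gt_0_iff)
  ultimately show ?thesis by (simp add: pos_divide_le_eq)
qed

theorem theorem1p10:
  fixes n k :: nat and \<epsilon> :: real and \<F> \<G> :: "nat set set"
  assumes "3 \<le> k" and "k \<le> n"
    and "0 < \<epsilon>" and "\<epsilon> \<le> 1 / 58"
    and "\<F> \<subseteq> nsets {1..n} k" and "\<G> \<subseteq> nsets {1..n} k"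
    and "cross_intersecting \<F> \<G>"
    and "real (card \<F>) \<ge> 1 / \<epsilon> * real ((n - 3) choose (k - 3))"
    and "real (card \<G>) \<ge> 1 / \<epsilon> * real ((n - 3) choose (k - 3))"
  shows "max (rho n \<F>) (rho n \<G>) > 1 / 2 - \<epsilon>"
proof (rule ccontr)
  assume "\<not> ?thesis"
  then have rho: "rho n \<F> \<le> 1 / 2 - \<epsilon>" "rho n \<G> \<le> 1 / 2 - \<epsilon>" by auto
  let ?N = "(n - 3) choose (k - 3)"
  have N: "0 < ?N" using assms(1,2) by (simp add: zero_less_binomial)
  have small: "real ?N \<le> \<epsilon> * real (card \<H>)" "58 * (\<epsilon> * real (card \<H>)) \<le> real (card \<H>)"
    and degree: "\<And>v. v \<in> {1..n} \<Longrightarrow> real (card {A \<in> \<H>. v \<in> A}) \<le> real (card \<H>) / 2 - \<epsilon> * real (card \<H>)"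
    if "\<H> \<subseteq> nsets {1..n} k" "real (card \<H>) \<ge> 1 / \<epsilon> * real ?N" "rho n \<H> \<le> 1 / 2 - \<epsilon>" for \<H>
  proof -
    show N_le: "real ?N \<le> \<epsilon> * real (card \<H>)" using that(2) assms(3) by (simp add: field_simps)
    have "58 * \<epsilon> * real (card \<H>) \<le> 1 * real (card \<H>)"
      by (rule mult_right_mono) (use assms(4) in auto)
    then show "58 * (\<epsilon> * real (card \<H>)) \<le> real (card \<H>)" by simp
    have "card \<H> \<noteq> 0" using N_le N by (intro notI) simp
    then have fin: "finite \<H>" "\<H> \<noteq> {}" using card_gt_0_iff by blast+
    fix v assume "v \<in> {1..n}"
    then have "real (card {A \<in> \<H>. v \<in> A}) \<le> rho n \<H> * real (card \<H>)" by (rule degree_le_rho[OF fin])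
    also have "\<dots> \<le> (1 / 2 - \<epsilon>) * real (card \<H>)" by (rule mult_right_mono[OF that(3)]) simp
    finally show "real (card {A \<in> \<H>. v \<in> A}) \<le> real (card \<H>) / 2 - \<epsilon> * real (card \<H>)"
      by (simp add: algebra_simps)
  qed
  note F = assms(5,8) rho(1) and G = assms(6,9) rho(2)
  have "58 * ?N \<le> card \<F>" using small[OF F] by linarith
  also have "card \<F> \<le> card (nsets {1..n} k)"
    using assms(5) by (intro card_mono) (auto simp: finite_imp_finite_nsets)
  also have "\<dots> = n choose k" by (simp add: card_nsets)
  finally have "2 * k \<le> n" using twice_le_of_choose_ge[OF assms(1,2)] N by linarith
  then have "bounded_pair n k \<F> \<G> (\<epsilon> * real (card \<F>)) (\<epsilon> * real (card \<G>))"
    using assms(1,5,6,7) small[OF F] small[OF G] degree[OF F] degree[OF G] by unfold_locales auto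
  then show False by (rule bounded_pair.inconsistent)
qed

end
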